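(* Let $p\in[-1,2]$ and let $f_p:\mathbb{R}^+\to\mathbb{R}^+$ be the function of the Stolarsky mean, $$f_p(x)=\left(\frac{p(x-1)}{x^p-1}\right)^{\frac{1}{1-p}}\quad (x\ne 1,\ p\neq 0,1),\qquad f_p(1)=1,$$ with the limiting cases $f_0(x)=\frac{x-1}{\log x}$ and $f_1(x)=\frac1e x^{\frac{x}{x-1}}$ for $x\neq 1$. Then the mapping $\beta=(\mathbb{J}_D^{f_p})^{-1}$ is monotone and completely positive. That is: (i) (monotonicity) for all $n,m\ge1$, every positive definite $D\in\mathbf{M}_n$ and every completely positive trace preserving linear mapping $\alpha:\mathbf{M}_n\to\mathbf{M}_m$ such that $\alpha(D)$ is positive definite, $$\alpha^*\,(\mathbb{J}_{\alpha(D)}^{f_p})^{-1}\,\alpha\le(\mathbb{J}_D^{f_p})^{-1};$$ (ii) for every $n\ge 1$ and every positive definite $D\in\mathbf{M}_n$, the mapping $(\mathbb{J}_D^{f_p})^{-1}:\mathbf{M}_n\to\mathbf{M}_n$ is completely positive.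
   Context: $\mathbf{M}_n$ is the algebra of $n\times n$ complex matrices with the Hilbert–Schmidt inner product $\langle A,B\rangle=\mathrm{Tr}\,A^*B$, and $\mathbb{R}^+=(0,\infty)$. For a function $f:\mathbb{R}^+\to\mathbb{R}^+$ put $m_f(x,y)=x f(y/x)$. For a positive definite $D\in\mathbf{M}_n$ let $\mathbb{L}_D(X)=DX$, $\mathbb{R}_D(X)=XD$, and define $\mathbb{J}_D^f=f(\mathbb{L}_D\mathbb{R}_D^{-1})\mathbb{R}_D:\mathbf{M}_n\to\mathbf{M}_n$. If $f$ satisfies $t f(t^{-1})=f(t)$ (as the functions in the claim do) and $D=\mathrm{Diag}(\lambda_1,\dots,\lambda_n)$, then $(\mathbb{J}_D^f A)_{ij}=A_{ij}\,m_f(\lambda_i,\lambda_j)$. In (i), $\alpha^*$ is the adjoint of $\alpha$ with respect to the Hilbert–Schmidt inner products, and $\le$ is the usual order between self-adjoint operators on the Hilbert space $\mathbf{M}_n$. *)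

theory Defs
  imports "HOL-Analysis.Analysis"
begin

definition cinner :: "complex^'n \<Rightarrow> complex^'n \<Rightarrow> complex" where
  "cinner x y = (\<Sum>i\<in>UNIV. cnj (x $ i) * y $ i)"

definition conj_transpose :: "complex^'n^'m \<Rightarrow> complex^'m^'n" where
  "conj_transpose A = (\<chi> i j. cnj (A $ j $ i))"

definition mscale :: "complex \<Rightarrow> complex^'n^'m \<Rightarrow> complex^'n^'m" where
  "mscale c A = (\<chi> i j. c * A $ i $ j)"

definition hs_inner :: "complex^'n^'n \<Rightarrow> complex^'n^'n \<Rightarrow> complex" where
  "hs_inner A B = trace (conj_transpose A ** B)"

definition pos_def :: "complex^'n^'n \<Rightarrow> bool" where
  "pos_def D \<longleftrightarrow> conj_transpose D = D \<and>
     (\<forall>x. x \<noteq> 0 \<longrightarrow> 0 < Re (cinner x (D *v x)))"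

section \<open>Linear maps between matrix algebras\<close>

text \<open>\<open>mscale\<close> is the complex scalar multiplication of matrices; the library's \<open>linear\<close> would
  only say real-linear.\<close>

lemma vector_space_mscale: "vector_space (mscale :: complex \<Rightarrow> complex^'n^'m \<Rightarrow> _)"
  by unfold_locales (auto simp: mscale_def vec_eq_iff algebra_simps)

text \<open>The family \<open>A i j\<close>, \<open>i, j < k\<close>, is read as a \<open>k \<times> k\<close> block matrix with blocks in
  \<open>M\<^sub>n\<close>, acting on \<open>k\<close>-tuples of vectors. Membership in the nonnegative reals also forces the
  quadratic form to be real, i.e. the block matrix to be Hermitian.\<close>

definition block_psd :: "nat \<Rightarrow> (nat \<Rightarrow> nat \<Rightarrow> complex^'n^'n) \<Rightarrow> bool" where
  "block_psd k A \<longleftrightarrow>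
     (\<forall>x :: nat \<Rightarrow> complex^'n. (\<Sum>i<k. \<Sum>j<k. cinner (x i) (A i j *v x j)) \<in> \<real>\<^sub>\<ge>\<^sub>0)"

definition completely_positive :: "(complex^'n^'n \<Rightarrow> complex^'m^'m) \<Rightarrow> bool" where
  "completely_positive \<alpha> \<longleftrightarrow> Vector_Spaces.linear mscale mscale \<alpha> \<and>
     (\<forall>k A. block_psd k A \<longrightarrow> block_psd k (\<lambda>i j. \<alpha> (A i j)))"

definition trace_preserving :: "(complex^'n^'n \<Rightarrow> complex^'m^'m) \<Rightarrow> bool" where
  "trace_preserving \<alpha> \<longleftrightarrow> (\<forall>A. trace (\<alpha> A) = trace A)"

definition hs_adjoint ::
    "(complex^'n^'n \<Rightarrow> complex^'m^'m) \<Rightarrow> complex^'m^'m \<Rightarrow> complex^'n^'n" where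
  "hs_adjoint \<alpha> = (THE \<beta>. \<forall>X Y. hs_inner (\<alpha> X) Y = hs_inner X (\<beta> Y))"

definition self_adjoint_op :: "(complex^'n^'n \<Rightarrow> complex^'n^'n) \<Rightarrow> bool" where
  "self_adjoint_op T \<longleftrightarrow> Vector_Spaces.linear mscale mscale T \<and>
     (\<forall>X Y. hs_inner (T X) Y = hs_inner X (T Y))"

definition op_le ::
    "(complex^'n^'n \<Rightarrow> complex^'n^'n) \<Rightarrow> (complex^'n^'n \<Rightarrow> complex^'n^'n) \<Rightarrow> bool" where
  "op_le S T \<longleftrightarrow> self_adjoint_op S \<and> self_adjoint_op T \<and>
     (\<forall>X. Re (hs_inner X (S X)) \<le> Re (hs_inner X (T X)))"

section \<open>Functional calculus\<close>

definition eigenspace_op ::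
    "(complex^'n^'n \<Rightarrow> complex^'n^'n) \<Rightarrow> complex \<Rightarrow> (complex^'n^'n) set" where
  "eigenspace_op T \<mu> = {X. T X = mscale \<mu> X}"

definition orth_proj :: "(complex^'n^'n) set \<Rightarrow> complex^'n^'n \<Rightarrow> complex^'n^'n" where
  "orth_proj S X = (THE Y. Y \<in> S \<and> (\<forall>Z\<in>S. hs_inner Z (X - Y) = 0))"

text \<open>\<open>f(T)\<close> by the spectral decomposition of a self-adjoint operator \<open>T\<close>; since the eigenvalues
  of such a \<open>T\<close> are real, the sum ranges over the whole spectrum.\<close>

definition fun_calc ::
    "(real \<Rightarrow> real) \<Rightarrow> (complex^'n^'n \<Rightarrow> complex^'n^'n) \<Rightarrow> complex^'n^'n \<Rightarrow> complex^'n^'n" where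
  "fun_calc f T X =
     (\<Sum>\<mu> | eigenspace_op T (complex_of_real \<mu>) \<noteq> {0}.
        mscale (complex_of_real (f \<mu>)) (orth_proj (eigenspace_op T (complex_of_real \<mu>)) X))"

definition L_op :: "complex^'n^'n \<Rightarrow> complex^'n^'n \<Rightarrow> complex^'n^'n" where
  "L_op D X = D ** X"

definition R_op :: "complex^'n^'n \<Rightarrow> complex^'n^'n \<Rightarrow> complex^'n^'n" where
  "R_op D X = X ** D"

definition J_op :: "(real \<Rightarrow> real) \<Rightarrow> complex^'n^'n \<Rightarrow> complex^'n^'n \<Rightarrow> complex^'n^'n" where
  "J_op f D = fun_calc f (L_op D \<circ> inv (R_op D)) \<circ> R_op D"

section \<open>The Stolarsky function\<close>

text \<open>Only the values at positive \<open>x\<close> are meaningful.\<close>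

definition stolarsky :: "real \<Rightarrow> real \<Rightarrow> real" where
  "stolarsky p x =
     (if x = 1 then 1
      else if p = 0 then (x - 1) / ln x
      else if p = 1 then 1 / exp 1 * x powr (x / (x - 1))
      else (p * (x - 1) / (x powr p - 1)) powr (1 / (1 - p)))"

end

theory Submission
  imports Defs
begin

text \<open>In an orthonormal eigenbasis of \<open>D\<close> the operator \<open>J_op (stolarsky p) D\<close>
  multiplies the matrix entry with eigenvalues \<open>x\<close> and \<open>y\<close> by the Stolarsky mean
  \<open>S\<^sub>p(x, y)\<close>, so its inverse multiplies by the reciprocal (\<open>J_op_multiplier\<close>,
  \<open>inv_J_op_stolarsky\<close>). Both claims become statements about this kernel. The mean is continuous
  in \<open>p\<close>, which disposes of the orders \<open>-1\<close>, \<open>0\<close>, \<open>1\<close> and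
  \<open>2\<close>, and \<open>S\<^sub>-\<^sub>q\<close> is a weighted geometric mean of \<open>sqrt (x
  y)\<close> and \<open>S\<^sub>q\<close>, which reduces negative orders to positive ones.

  Monotonicity. By duality it suffices that \<open>\<alpha> J \<alpha>\<^sup>* \<le> J'\<close> for the
  operators \<open>J\<close>, \<open>J'\<close> of \<open>D\<close> and \<open>\<alpha> D\<close>. For the
  kernels \<open>x\<close> and \<open>y\<close>, that is for left and right multiplication, this is a Schwarz
  inequality, which follows from 2-positivity (\<open>adjoint_schwarz\<close>). The kernels with this property
  are closed under positive combinations, limits and parallel sums \<open>a b / (a + b)\<close>, the last
  because the quadratic form of a parallel sum is an infimum over splittings
  (\<open>dominated_parallel\<close>). Everything else is built from these: the geometric mean is the limit of
  the arithmetic-harmonic iteration, weighted geometric means follow by bisection of the exponent, and a power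
  mean of order between \<open>-1\<close> and \<open>1\<close> is the limit of a fixed-point iteration made of
  weighted geometric means. Finally \<open>S\<^sub>p\<close> is the power mean of order \<open>p - 1\<close>
  of the weighted arithmetic means \<open>s x + (1 - s) y\<close> with respect to \<open>s\<close> in
  \<open>[0, 1]\<close>.

  Complete positivity. A multiplier is completely positive if its kernel is positive semidefinite. The
  reciprocal of \<open>S\<^sub>p\<close> is a power of \<open>(x powr q - y powr q) / (x - y)\<close> with
  \<open>0 < q < 1\<close>, up to harmless factors, so all positive powers of this divided difference must be
  positive semidefinite. For \<open>q = k / m\<close> and in the variables \<open>x powr (1 / m)\<close> it is
  a product of ratios \<open>r\<^sub>n\<close> of consecutive divided differences of the powers \<open>x ^
  n\<close>, and these satisfy \<open>1 / r\<^sub>n\<^sub>+\<^sub>1 = x + y - x y r\<^sub>n\<close>. If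
  \<open>r\<^sub>n\<close> is positive semidefinite, then the right-hand side is a rank-one kernel times
  \<open>1 - t\<close> with \<open>t\<close> positive semidefinite, and the binomial series shows that all its
  negative powers are positive semidefinite (\<open>schur_positive_sum_minus_powr\<close>).\<close>

section \<open>The Hermitian inner product\<close>

lemma cinner_add_right: "cinner x (y + z) = cinner x y + cinner x z"
  by (simp add: cinner_def algebra_simps sum.distrib)

lemma cinner_add_left: "cinner (x + y) z = cinner x z + cinner y z"
  by (simp add: cinner_def algebra_simps sum.distrib)

lemma cinner_diff_right: "cinner x (y - z) = cinner x y - cinner x z"
  by (simp add: cinner_def algebra_simps sum_subtractf)

lemma cinner_scale_right: "cinner x (c *s y) = c * cinner x y"
  by (simp add: cinner_def sum_distrib_left mult_ac)

lemma cinner_scale_left: "cinner (c *s x) y = cnj c * cinner x y"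
  by (simp add: cinner_def sum_distrib_left mult_ac)

lemma cinner_zero [simp]: "cinner 0 x = 0" "cinner x 0 = 0"
  by (simp_all add: cinner_def)

lemma cinner_sum_right: "cinner x (sum f A) = (\<Sum>a\<in>A. cinner x (f a))"
  by (induction A rule: infinite_finite_induct) (simp_all add: cinner_add_right)

lemma cinner_sum_left: "cinner (sum f A) x = (\<Sum>a\<in>A. cinner (f a) x)"
  by (induction A rule: infinite_finite_induct) (simp_all add: cinner_add_left)

lemma cnj_cinner: "cnj (cinner x y) = cinner y x"
  by (simp add: cinner_def mult.commute)

lemma Re_cinner: "Re (cinner x y) = x \<bullet> y"
  by (simp add: cinner_def inner_vec_def inner_complex_def)

lemma cinner_self: "cinner x x = of_real ((norm x)\<^sup>2)"
proof (rule complex_eqI)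
  show "Re (cinner x x) = Re (of_real ((norm x)\<^sup>2))"
    by (simp add: Re_cinner power2_norm_eq_inner)
  show "Im (cinner x x) = Im (of_real ((norm x)\<^sup>2))"
    by (simp add: cinner_def mult.commute)
qed

lemma cinner_adjoint: "cinner x (A *v y) = cinner (conj_transpose A *v x) y"
proof -
  have "cinner x (A *v y) = (\<Sum>i\<in>UNIV. \<Sum>j\<in>UNIV. cnj (x $ i) * A $ i $ j * y $ j)"
    by (simp add: cinner_def matrix_vector_mult_def sum_distrib_left mult.assoc)
  also have "\<dots> = (\<Sum>j\<in>UNIV. \<Sum>i\<in>UNIV. cnj (x $ i) * A $ i $ j * y $ j)"
    by (rule sum.swap)
  also have "\<dots> = cinner (conj_transpose A *v x) y"
    by (simp add: cinner_def matrix_vector_mult_def conj_transpose_def sum_distrib_right sum_distrib_left mult_ac)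
  finally show ?thesis .
qed

lemma conj_transpose_twice [simp]: "conj_transpose (conj_transpose A) = A"
  by (simp add: conj_transpose_def vec_eq_iff)

lemma matrix_vector_scale: "(A :: complex^'n^'m) *v (c *s x) = c *s (A *v x)"
  by (simp add: vec_eq_iff matrix_vector_mult_def sum_distrib_left mult_ac)

lemma matrix_vector_sum: "(A :: complex^'n^'m) *v (sum f S) = (\<Sum>s\<in>S. A *v f s)"
  by (induction S rule: infinite_finite_induct) (simp_all add: matrix_vector_right_distrib)

lemma mscale_vector: "mscale c A *v x = c *s (A *v x)"
  by (simp add: vec_eq_iff matrix_vector_mult_def mscale_def sum_distrib_left mult_ac)

lemma of_real_scale_vector: "complex_of_real r *s x = r *\<^sub>R x"
  by (simp add: vec_eq_iff scaleR_conv_of_real[symmetric])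

lemma matrix_vector_scaleR: "(A :: complex^'n^'m) *v (r *\<^sub>R x) = r *\<^sub>R (A *v x)"
  by (simp add: matrix_vector_scale flip: of_real_scale_vector)

section \<open>Orthonormal eigenbases\<close>

definition orthonormal_set :: "(complex^'n) set \<Rightarrow> bool" where
  "orthonormal_set U \<longleftrightarrow> (\<forall>u\<in>U. \<forall>v\<in>U. cinner u v = (if u = v then 1 else 0))"

text \<open>Orthogonality for the Hermitian form implies orthogonality for the underlying real inner product,
  so an orthonormal set is independent over the reals. The resulting bound is twice the complex dimension, and
  any bound serves for picking an orthonormal set of maximal size.\<close>

lemma orthonormal_set_finite_card:
  fixes U :: "(complex^'n) set"
  assumes "orthonormal_set U"
  shows "finite U" "card U \<le> DIM(complex^'n)"
proof -
  have "pairwise orthogonal U"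
    using assms by (auto simp: pairwise_def orthogonal_def orthonormal_set_def Re_cinner[symmetric])
  moreover have "0 \<notin> U"
  proof
    assume "0 \<in> U"
    then have "cinner (0 :: complex^'n) 0 = 1" using assms unfolding orthonormal_set_def by metis
    then show False by simp
  qed
  ultimately have "independent U" by (rule pairwise_orthogonal_independent)
  then show "finite U" "card U \<le> DIM(complex^'n)" using independent_bound[of U] by blast+
qed

text \<open>The basis is a set of vectors rather than a family indexed by the type of the coordinates, so that
  it can be grown one eigenvector at a time. Every eigenvalue is stored as a real number, which is what a
  Hermitian matrix provides.\<close>

definition eigenbasis :: "complex^'n^'n \<Rightarrow> (complex^'n) set \<Rightarrow> (complex^'n \<Rightarrow> real) \<Rightarrow> bool" where
  "eigenbasis D U l \<longleftrightarrow> orthonormal_set U \<and> (\<forall>u\<in>U. D *v u = of_real (l u) *s u) \<and>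
     (\<forall>x. (\<Sum>u\<in>U. cinner u x *s u) = x)"

text \<open>The first-order condition at a maximum, in the form in which the Rayleigh quotient uses
  it.\<close>

lemma quadratic_nonpos_imp_linear_zero:
  fixes a b :: real
  assumes "\<And>t. 2 * t * a + t\<^sup>2 * b \<le> 0"
  shows "a = 0"
proof (rule ccontr)
  assume "a \<noteq> 0"
  define c where "c = \<bar>b\<bar> + 1"
  define t where "t = a / c"
  have c: "0 < c" "0 < 2 * c + b" by (auto simp: c_def)
  have "2 * t * a + t\<^sup>2 * b = a\<^sup>2 / c\<^sup>2 * (2 * c + b)"
    using c(1) by (simp add: t_def power2_eq_square field_simps)
  moreover have "0 < a\<^sup>2 / c\<^sup>2 * (2 * c + b)"
    using \<open>a \<noteq> 0\<close> c by (intro mult_pos_pos divide_pos_pos) auto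
  ultimately show False using assms[of t] by simp
qed

text \<open>The Rayleigh quotient attains its maximum \<open>l\<close> on the compact unit sphere of the
  subspace, at some \<open>w\<close>. With \<open>z = D w - l w\<close>, which lies in the subspace by
  invariance, the inequality \<open>\<langle>x, D x\<rangle> \<le> l \<parallel>x\<parallel>\<^sup>2\<close>
  along the line \<open>w + t z\<close> has linear term \<open>2 t \<parallel>z\<parallel>\<^sup>2\<close>,
  hence \<open>z = 0\<close>.\<close>

lemma hermitian_eigenvector_in_invariant_subspace:
  fixes D :: "complex^'n^'n" and W :: "(complex^'n) set"
  assumes D: "conj_transpose D = D"
    and W: "subspace W" "W \<noteq> {0}" and inv: "\<And>x. x \<in> W \<Longrightarrow> D *v x \<in> W"
  obtains w l where "w \<in> W" "norm w = 1" "D *v w = of_real l *s w"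
proof -
  define Q where "Q x = Re (cinner x (D *v x))" for x
  have cont: "continuous_on S Q" for S
    unfolding Q_def cinner_def matrix_vector_mult_def by (intro continuous_intros)
  have "compact (sphere 0 1 \<inter> W)"
    using closed_subspace[OF W(1)] by (intro compact_Int_closed) auto
  moreover have "sphere 0 1 \<inter> W \<noteq> {}"
  proof -
    obtain x where x: "x \<in> W" "x \<noteq> 0" using W subspace_0 by blast
    then have "(1 / norm x) *\<^sub>R x \<in> sphere 0 1 \<inter> W"
      using W(1) by (auto simp: subspace_scale)
    then show ?thesis by blast
  qed
  ultimately obtain w where w: "w \<in> sphere 0 1 \<inter> W" and max: "\<forall>y \<in> sphere 0 1 \<inter> W. Q y \<le> Q w"
    using continuous_attains_sup[OF _ _ cont] by blast
  have nw: "norm w = 1" and wW: "w \<in> W" using w by auto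
  define l where "l = Q w"
  define z where "z = D *v w - l *\<^sub>R w"
  have z: "z \<in> W"
    unfolding z_def using W(1) inv wW by (intro subspace_diff subspace_scale) auto
  have rayleigh: "Q x \<le> l * (norm x)\<^sup>2" if "x \<in> W" for x
  proof (cases "x = 0")
    case False
    define c where "c = 1 / norm x"
    have "c *\<^sub>R x \<in> sphere 0 1 \<inter> W"
      using that False W(1) by (auto simp: c_def subspace_scale)
    then have "Q (c *\<^sub>R x) \<le> l" using max by (simp add: l_def)
    moreover have "Q (c *\<^sub>R x) = c\<^sup>2 * Q x"
      by (simp add: Q_def Re_cinner power2_eq_square matrix_vector_scaleR)
    ultimately have "(norm x)\<^sup>2 * (c\<^sup>2 * Q x) \<le> (norm x)\<^sup>2 * l"
      by (intro mult_left_mono) auto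
    then show ?thesis using False by (simp add: c_def power_divide mult.commute)
  qed (simp add: Q_def)
  have sym: "x \<bullet> (D *v y) = (D *v x) \<bullet> y" for x y
    using cinner_adjoint[of x D y] D by (simp flip: Re_cinner)
  have "(norm z)\<^sup>2 = 0"
  proof (rule quadratic_nonpos_imp_linear_zero)
    fix t :: real
    have "w + t *\<^sub>R z \<in> W" using wW z W(1) by (simp add: subspace_add subspace_scale)
    then have "Q (w + t *\<^sub>R z) \<le> l * (norm (w + t *\<^sub>R z))\<^sup>2" by (rule rayleigh)
    moreover have "Q (w + t *\<^sub>R z) = l + 2 * t * ((D *v w) \<bullet> z) + t\<^sup>2 * Q z"
      using sym[of w z] by (simp add: Q_def l_def Re_cinner inner_add_left inner_add_right
         matrix_vector_right_distrib matrix_vector_scaleR power2_eq_square inner_commute[of z "D *v w"] distrib_left)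
    moreover have "(norm (w + t *\<^sub>R z))\<^sup>2 = 1 + 2 * t * (w \<bullet> z) + t\<^sup>2 * (norm z)\<^sup>2"
      unfolding power2_norm_eq_inner using nw
      by (simp add: norm_eq_1 inner_add_left inner_add_right inner_commute[of z w] power2_eq_square distrib_left)
    ultimately have "2 * t * ((D *v w) \<bullet> z - l * (w \<bullet> z)) + t\<^sup>2 * (Q z - l * (norm z)\<^sup>2) \<le> 0"
      by (simp add: algebra_simps)
    moreover have "(D *v w) \<bullet> z - l * (w \<bullet> z) = (norm z)\<^sup>2"
      by (simp add: power2_norm_eq_inner z_def inner_diff_left)
    ultimately show "2 * t * (norm z)\<^sup>2 + t\<^sup>2 * (Q z - l * (norm z)\<^sup>2) \<le> 0"
      by (simp only:)
  qed
  then have "D *v w = of_real l *s w" by (simp add: z_def of_real_scale_vector)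
  with wW nw show ?thesis by (rule that)
qed

text \<open>The spectral theorem. The orthogonal complement of an orthonormal set of eigenvectors is
  invariant, so if it were nonzero it would contain a further eigenvector; a set of maximal size therefore
  spans.\<close>

lemma hermitian_eigenbasis:
  fixes D :: "complex^'n^'n"
  assumes D: "conj_transpose D = D"
  obtains U l where "eigenbasis D U l"
proof -
  define P where "P U \<longleftrightarrow> orthonormal_set U \<and> (\<forall>u\<in>U. \<exists>l. D *v u = complex_of_real l *s u)"
    for U :: "(complex^'n) set"
  define N where "N = card ` Collect P"
  have "finite N"
  proof (rule finite_subset)
    show "N \<subseteq> {..DIM(complex^'n)}"
      using orthonormal_set_finite_card(2) unfolding N_def P_def by blast
  qed simp
  moreover have "P {}" by (simp add: P_def orthonormal_set_def)
  then have "N \<noteq> {}" by (auto simp: N_def)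
  ultimately have "Max N \<in> N" by (rule Max_in)
  then obtain U where U: "P U" and cU: "card U = Max N" by (auto simp: N_def)
  have on: "orthonormal_set U" using U by (simp add: P_def)
  note fin = orthonormal_set_finite_card(1)[OF on]
  define W where "W = {x. \<forall>u\<in>U. cinner u x = 0}"
  have W0: "W = {0}"
  proof (rule ccontr)
    assume "W \<noteq> {0}"
    moreover have "subspace W"
      by (simp add: subspace_def W_def cinner_add_right cinner_scale_right flip: of_real_scale_vector)
    moreover have "D *v x \<in> W" if "x \<in> W" for x
    proof -
      have "cinner u (D *v x) = 0" if u: "u \<in> U" for u
      proof -
        obtain l where "D *v u = complex_of_real l *s u" using U u by (auto simp: P_def)
        then show ?thesis using \<open>x \<in> W\<close> u D by (simp add: cinner_adjoint W_def cinner_scale_left)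
      qed
      then show ?thesis by (simp add: W_def)
    qed
    ultimately obtain w l where w: "w \<in> W" "norm w = 1" "D *v w = complex_of_real l *s w"
      using hermitian_eigenvector_in_invariant_subspace[OF D] by metis
    have ww: "cinner w w = 1" using w(2) by (simp add: cinner_self)
    then have notin: "w \<notin> U" using w(1) by (auto simp: W_def)
    have uw: "cinner u w = 0" "cinner w u = 0" if "u \<in> U" for u
      using w(1) that cnj_cinner[of u w] by (auto simp: W_def)
    have "orthonormal_set (insert w U)"
      using on ww uw notin by (auto simp: orthonormal_set_def)
    then have "P (insert w U)" using U w(3) unfolding P_def by blast
    then have "card (insert w U) \<le> Max N"
      using \<open>finite N\<close> by (intro Max_ge) (auto simp: N_def)
    then show False using notin fin cU by simp
  qed
  define l where "l u = (SOME l. D *v u = complex_of_real l *s u)" for u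
  have "D *v u = of_real (l u) *s u" if "u \<in> U" for u
  proof -
    have "\<exists>l. D *v u = complex_of_real l *s u" using U that by (simp add: P_def)
    then show ?thesis unfolding l_def by (rule someI_ex)
  qed
  moreover have "(\<Sum>u\<in>U. cinner u x *s u) = x" for x
  proof -
    have "x - (\<Sum>u\<in>U. cinner u x *s u) \<in> W"
    proof -
      have "cinner v (\<Sum>u\<in>U. cinner u x *s u) = cinner v x" if v: "v \<in> U" for v
      proof -
        have "cinner v (\<Sum>u\<in>U. cinner u x *s u) = (\<Sum>u\<in>U. if u = v then cinner u x else 0)"
          unfolding cinner_sum_right cinner_scale_right
          using on v by (intro sum.cong refl) (auto simp: orthonormal_set_def)
        then show ?thesis using fin v by simp
      qed
      then show ?thesis by (simp add: W_def cinner_diff_right)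
    qed
    then show ?thesis unfolding W0 by simp
  qed
  ultimately show ?thesis using on by (intro that[of U l]) (auto simp: eigenbasis_def)
qed

lemma eigenbasis_cinner:
  "eigenbasis D U l \<Longrightarrow> u \<in> U \<Longrightarrow> v \<in> U \<Longrightarrow> cinner u v = (if u = v then 1 else 0)"
  by (simp add: eigenbasis_def orthonormal_set_def)

lemma eigenbasis_finite: "eigenbasis D U l \<Longrightarrow> finite U"
  by (simp add: eigenbasis_def orthonormal_set_finite_card)

lemma eigenbasis_expand: "eigenbasis D U l \<Longrightarrow> (\<Sum>u\<in>U. cinner u x *s u) = x"
  by (simp add: eigenbasis_def)

lemma eigenbasis_eigenvector: "eigenbasis D U l \<Longrightarrow> u \<in> U \<Longrightarrow> D *v u = of_real (l u) *s u"
  by (simp add: eigenbasis_def)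

lemma eigenbasis_pos:
  assumes "pos_def D" "eigenbasis D U l" "u \<in> U"
  shows "0 < l u"
proof -
  have uu: "cinner u u = 1" using eigenbasis_cinner[OF assms(2,3,3)] by simp
  then have "u \<noteq> 0" by auto
  then have "0 < Re (cinner u (D *v u))" using assms(1) by (simp add: pos_def_def)
  then show ?thesis by (simp add: eigenbasis_eigenvector[OF assms(2,3)] cinner_scale_right uu)
qed

lemma cinner_parseval:
  assumes "eigenbasis D U l"
  shows "cinner x y = (\<Sum>u\<in>U. cinner x u * cinner u y)"
proof -
  have "cinner x y = cinner x (\<Sum>u\<in>U. cinner u y *s u)"
    by (simp only: eigenbasis_expand[OF assms])
  then show ?thesis by (simp add: cinner_sum_right cinner_scale_right mult.commute)
qed

lemma eigenbasis_trace:
  assumes U: "eigenbasis D U l"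
  shows "trace A = (\<Sum>u\<in>U. cinner u (A *v u))"
proof -
  have delta: "(\<Sum>u\<in>U. cnj (u $ i) * u $ j) = (if i = j then 1 else 0)" for i j
  proof -
    have "cinner u (axis i 1) = cnj (u $ i)" for u :: "complex^'a"
      by (simp add: cinner_def axis_def if_distrib[of "\<lambda>x. _ * x"] cong: if_cong)
    then have "(\<Sum>u\<in>U. cnj (u $ i) * u $ j) = (\<Sum>u\<in>U. cinner u (axis i 1) *s u) $ j"
      by simp
    also have "\<dots> = (if i = j then 1 else 0)"
      unfolding eigenbasis_expand[OF U] by (auto simp: axis_def)
    finally show ?thesis .
  qed
  have "(\<Sum>u\<in>U. cinner u (A *v u)) = (\<Sum>u\<in>U. \<Sum>i\<in>UNIV. \<Sum>j\<in>UNIV. A $ i $ j * (cnj (u $ i) * u $ j))"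
    by (simp add: cinner_def matrix_vector_mult_def sum_distrib_left mult_ac)
  also have "\<dots> = (\<Sum>i\<in>UNIV. \<Sum>j\<in>UNIV. A $ i $ j * (\<Sum>u\<in>U. cnj (u $ i) * u $ j))"
    unfolding sum_distrib_left by (subst sum.swap, intro sum.cong refl, rule sum.swap)
  also have "\<dots> = trace A"
    unfolding delta by (simp add: trace_def if_distrib[of "\<lambda>x. _ * x"] cong: if_cong)
  finally show ?thesis ..
qed

section \<open>Matrix coefficients\<close>

definition mat_coeff :: "complex^'n^'n \<Rightarrow> complex^'n \<Rightarrow> complex^'n \<Rightarrow> complex" where
  "mat_coeff X u v = cinner u (X *v v)"

definition outer :: "complex^'n \<Rightarrow> complex^'n \<Rightarrow> complex^'n^'n" where
  "outer u v = (\<chi> i j. u $ i * cnj (v $ j))"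

lemma outer_vector: "outer u v *v w = cinner v w *s u"
  by (simp add: vec_eq_iff outer_def matrix_vector_mult_def cinner_def sum_distrib_left mult_ac)

lemma mat_coeff_add: "mat_coeff (X + Y) u v = mat_coeff X u v + mat_coeff Y u v"
  by (simp add: mat_coeff_def matrix_vector_mult_add_rdistrib cinner_add_right)

lemma mat_coeff_diff: "mat_coeff (X - Y) u v = mat_coeff X u v - mat_coeff Y u v"
  by (simp add: mat_coeff_def matrix_vector_mult_diff_rdistrib cinner_diff_right)

lemma mat_coeff_zero [simp]: "mat_coeff 0 u v = 0"
  by (simp add: mat_coeff_def)

lemma mat_coeff_mscale: "mat_coeff (mscale c X) u v = c * mat_coeff X u v"
  by (simp add: mat_coeff_def mscale_vector cinner_scale_right)

lemma mat_coeff_sum: "mat_coeff (sum f A) u v = (\<Sum>a\<in>A. mat_coeff (f a) u v)"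
  by (induction A rule: infinite_finite_induct) (simp_all add: mat_coeff_add)

lemma mat_coeff_outer: "mat_coeff (outer a b) u v = cinner u a * cinner b v"
  by (simp add: mat_coeff_def outer_vector cinner_scale_right mult.commute)

lemma mat_coeff_eqI:
  assumes U: "eigenbasis D U l"
    and eq: "\<And>u v. u \<in> U \<Longrightarrow> v \<in> U \<Longrightarrow> mat_coeff X u v = mat_coeff Y u v"
  shows "X = Y"
proof -
  have v: "X *v v = Y *v v" if "v \<in> U" for v
  proof -
    have "X *v v = (\<Sum>u\<in>U. cinner u (X *v v) *s u)" by (simp add: eigenbasis_expand[OF U])
    also have "\<dots> = (\<Sum>u\<in>U. cinner u (Y *v v) *s u)"
      using eq that by (intro sum.cong refl) (simp add: mat_coeff_def)
    also have "\<dots> = Y *v v" by (simp add: eigenbasis_expand[OF U])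
    finally show ?thesis .
  qed
  have "X *v x = Y *v x" for x
  proof -
    have "X *v (\<Sum>u\<in>U. cinner u x *s u) = Y *v (\<Sum>u\<in>U. cinner u x *s u)"
      by (simp add: matrix_vector_sum matrix_vector_scale v)
    then show ?thesis by (simp only: eigenbasis_expand[OF U])
  qed
  then show ?thesis by (simp add: matrix_eq)
qed

text \<open>The inverse of \<open>mat_coeff\<close>: the matrix with prescribed entries in the orthonormal
  basis \<open>U\<close>.\<close>

definition from_coeff :: "(complex^'n) set \<Rightarrow> ((complex^'n) \<times> (complex^'n) \<Rightarrow> complex) \<Rightarrow> complex^'n^'n" where
  "from_coeff U y = (\<Sum>(u, v)\<in>U \<times> U. mscale (y (u, v)) (outer u v))"

lemma mat_coeff_from_coeff:
  assumes U: "eigenbasis D U l" and uv: "u \<in> U" "v \<in> U"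
  shows "mat_coeff (from_coeff U y) u v = y (u, v)"
proof -
  have "mat_coeff (from_coeff U y) u v = (\<Sum>w\<in>U \<times> U. if w = (u, v) then y w else 0)"
    unfolding from_coeff_def mat_coeff_sum
    using uv by (intro sum.cong refl)
      (auto simp: mat_coeff_mscale mat_coeff_outer eigenbasis_cinner[OF U] split: prod.splits)
  then show ?thesis using uv eigenbasis_finite[OF U] by simp
qed

lemma from_coeff_mat_coeff:
  assumes U: "eigenbasis D U l"
  shows "from_coeff U (\<lambda>(u, v). mat_coeff X u v) = X"
  by (rule mat_coeff_eqI[OF U]) (simp add: mat_coeff_from_coeff[OF U])

lemma hs_inner_mat_coeff:
  assumes U: "eigenbasis D U l"
  shows "hs_inner X Y = (\<Sum>u\<in>U. \<Sum>v\<in>U. cnj (mat_coeff X u v) * mat_coeff Y u v)"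
proof -
  have "hs_inner X Y = (\<Sum>v\<in>U. cinner v (conj_transpose X *v (Y *v v)))"
    by (simp add: hs_inner_def eigenbasis_trace[OF U] matrix_vector_mul_assoc)
  also have "\<dots> = (\<Sum>v\<in>U. cinner (X *v v) (Y *v v))"
    by (simp add: cinner_adjoint)
  also have "\<dots> = (\<Sum>v\<in>U. \<Sum>u\<in>U. cnj (mat_coeff X u v) * mat_coeff Y u v)"
    by (subst cinner_parseval[OF U]) (simp add: mat_coeff_def cnj_cinner)
  finally show ?thesis by (subst sum.swap)
qed

section \<open>Schur multipliers and functional calculus\<close>

text \<open>Entrywise multiplication of a matrix, written in the basis \<open>U\<close>, by the real kernel
  \<open>K\<close> (a Schur multiplier). Left and right multiplication by a matrix with eigenbasis
  \<open>U\<close>, and everything that functional calculus makes of them, are of this form.\<close>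

definition multiplier ::
    "(complex^'n) set \<Rightarrow> (complex^'n \<Rightarrow> complex^'n \<Rightarrow> real) \<Rightarrow> complex^'n^'n \<Rightarrow> complex^'n^'n" where
  "multiplier U K X = from_coeff U (\<lambda>(u, v). of_real (K u v) * mat_coeff X u v)"

lemma mat_coeff_multiplier:
  "eigenbasis D U l \<Longrightarrow> u \<in> U \<Longrightarrow> v \<in> U \<Longrightarrow> mat_coeff (multiplier U K X) u v = of_real (K u v) * mat_coeff X u v"
  by (simp add: multiplier_def mat_coeff_from_coeff)

lemma multiplier_eqI:
  assumes "eigenbasis D U l"
    and "\<And>X u v. u \<in> U \<Longrightarrow> v \<in> U \<Longrightarrow> mat_coeff (T X) u v = of_real (K u v) * mat_coeff X u v"
  shows "T = multiplier U K"
  by (rule ext, rule mat_coeff_eqI[OF assms(1)]) (simp add: assms mat_coeff_multiplier[OF assms(1)])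

lemma mscale_linearI:
  fixes T :: "complex^'n^'n \<Rightarrow> complex^'m^'m"
  assumes "\<And>X Y. T (X + Y) = T X + T Y" "\<And>c X. T (mscale c X) = mscale c (T X)"
  shows "Vector_Spaces.linear mscale mscale T"
  by (rule Vector_Spaces.linear_iff[THEN iffD2]) (simp add: vector_space_mscale assms)

lemma multiplier_linear:
  assumes "eigenbasis D U l"
  shows "Vector_Spaces.linear mscale mscale (multiplier U K)"
  by (rule mscale_linearI; rule mat_coeff_eqI[OF assms];
      simp add: mat_coeff_add mat_coeff_mscale mat_coeff_multiplier[OF assms] distrib_left)

lemma multiplier_self_adjoint:
  assumes "eigenbasis D U l"
  shows "hs_inner (multiplier U K X) Y = hs_inner X (multiplier U K Y)"
  unfolding hs_inner_mat_coeff[OF assms]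
  by (intro sum.cong refl) (simp add: mat_coeff_multiplier[OF assms])

lemma multiplier_quadratic_form:
  assumes "eigenbasis D U l"
  shows "hs_inner X (multiplier U K X) = of_real (\<Sum>u\<in>U. \<Sum>v\<in>U. K u v * (cmod (mat_coeff X u v))\<^sup>2)"
  unfolding hs_inner_mat_coeff[OF assms] of_real_sum
  by (intro sum.cong refl) 
     (simp add: mat_coeff_multiplier[OF assms] complex_norm_square mult_ac del: of_real_power)

lemma multiplier_inverse:
  assumes U: "eigenbasis D U l" and K: "\<And>u v. u \<in> U \<Longrightarrow> v \<in> U \<Longrightarrow> K u v \<noteq> 0"
  shows "inv (multiplier U K) = multiplier U (\<lambda>u v. inverse (K u v))"
proof (rule inv_unique_comp)
  show "multiplier U K \<circ> multiplier U (\<lambda>u v. inverse (K u v)) = id"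
    by (rule ext, rule mat_coeff_eqI[OF U]) (simp add: mat_coeff_multiplier[OF U] K)
  show "multiplier U (\<lambda>u v. inverse (K u v)) \<circ> multiplier U K = id"
    by (rule ext, rule mat_coeff_eqI[OF U]) (simp add: mat_coeff_multiplier[OF U] K)
qed

lemma L_op_multiplier:
  assumes D: "conj_transpose D = D" and U: "eigenbasis D U l"
  shows "L_op D = multiplier U (\<lambda>u v. l u)"
proof (rule multiplier_eqI[OF U])
  fix X u v assume u: "u \<in> U"
  have "mat_coeff (L_op D X) u v = cinner (D *v u) (X *v v)"
    by (simp add: mat_coeff_def L_op_def matrix_vector_mul_assoc[symmetric] cinner_adjoint[of u D] D)
  then show "mat_coeff (L_op D X) u v = of_real (l u) * mat_coeff X u v"
    by (simp add: eigenbasis_eigenvector[OF U u] cinner_scale_left mat_coeff_def)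
qed

lemma R_op_multiplier:
  assumes U: "eigenbasis D U l"
  shows "R_op D = multiplier U (\<lambda>u v. l v)"
proof (rule multiplier_eqI[OF U])
  fix X u v assume v: "v \<in> U"
  show "mat_coeff (R_op D X) u v = of_real (l v) * mat_coeff X u v"
    by (simp add: mat_coeff_def R_op_def matrix_vector_mul_assoc[symmetric]
        eigenbasis_eigenvector[OF U v] matrix_vector_scale cinner_scale_right)
qed

text \<open>The eigenspace of a multiplier for \<open>\<mu>\<close> consists of the matrices supported on the
  entries where the kernel equals \<open>\<mu>\<close>, and the orthogonal projection onto it erases all other
  entries. So the spectral sum, taken over the values of the kernel, applies \<open>f\<close> to the
  kernel.\<close>

lemma fun_calc_multiplier:
  assumes U: "eigenbasis D U l"
  shows "fun_calc f (multiplier U K) = multiplier U (\<lambda>u v. f (K u v))"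
proof (rule multiplier_eqI[OF U])
  fix X :: "complex^'a^'a" and u v assume uv: "u \<in> U" "v \<in> U"
  define E where "E \<mu> = eigenspace_op (multiplier U K) (complex_of_real \<mu>)" for \<mu>
  have E: "X \<in> E \<mu> \<longleftrightarrow> (\<forall>u\<in>U. \<forall>v\<in>U. K u v \<noteq> \<mu> \<longrightarrow> mat_coeff X u v = 0)" for X \<mu>
  proof -
    have "X \<in> E \<mu> \<longleftrightarrow> (\<forall>u\<in>U. \<forall>v\<in>U. mat_coeff (multiplier U K X) u v = mat_coeff (mscale (of_real \<mu>) X) u v)"
      unfolding E_def eigenspace_op_def using mat_coeff_eqI[OF U] by auto
    also have "\<dots> \<longleftrightarrow> (\<forall>u\<in>U. \<forall>v\<in>U. K u v \<noteq> \<mu> \<longrightarrow> mat_coeff X u v = 0)"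
      by (auto simp: mat_coeff_multiplier[OF U] mat_coeff_mscale)
    finally show ?thesis .
  qed
  have proj: "orth_proj (E \<mu>) X = multiplier U (\<lambda>u v. if K u v = \<mu> then 1 else 0) X" for \<mu> X
    unfolding orth_proj_def
  proof (rule the_equality)
    let ?Y = "multiplier U (\<lambda>u v. if K u v = \<mu> then 1 else 0) X"
    show "?Y \<in> E \<mu> \<and> (\<forall>Z\<in>E \<mu>. hs_inner Z (X - ?Y) = 0)"
    proof (intro conjI ballI)
      show "?Y \<in> E \<mu>" by (simp add: E mat_coeff_multiplier[OF U])
      fix Z assume "Z \<in> E \<mu>"
      then show "hs_inner Z (X - ?Y) = 0"
        unfolding hs_inner_mat_coeff[OF U]
        by (intro sum.neutral ballI) (auto simp: E mat_coeff_diff mat_coeff_multiplier[OF U])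
    qed
    fix Y assume Y: "Y \<in> E \<mu> \<and> (\<forall>Z\<in>E \<mu>. hs_inner Z (X - Y) = 0)"
    show "Y = ?Y"
    proof (rule mat_coeff_eqI[OF U])
      fix u v assume uv: "u \<in> U" "v \<in> U"
      show "mat_coeff Y u v = mat_coeff ?Y u v"
      proof (cases "K u v = \<mu>")
        case False
        then show ?thesis using Y uv by (simp add: E mat_coeff_multiplier[OF U])
      next
        case True
        \<comment> \<open>Testing orthogonality against the matrix unit at \<open>(u, v)\<close> reads off that entry of \<open>Y\<close>.\<close>
        let ?Z = "from_coeff U (\<lambda>w. if w = (u, v) then 1 else 0)"
        have Z: "mat_coeff ?Z a b = (if (a, b) = (u, v) then 1 else 0)" if "a \<in> U" "b \<in> U" for a b
          using that by (simp add: mat_coeff_from_coeff[OF U])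
        have "?Z \<in> E \<mu>" using Z True by (auto simp: E)
        then have "0 = hs_inner ?Z (X - Y)" using Y by simp
        also have "\<dots> = (\<Sum>a\<in>U. \<Sum>b\<in>U. if (a, b) = (u, v) then mat_coeff (X - Y) a b else 0)"
          unfolding hs_inner_mat_coeff[OF U] by (intro sum.cong refl) (simp add: Z)
        also have "\<dots> = (\<Sum>w\<in>U \<times> U. if w = (u, v) then mat_coeff (X - Y) u v else 0)"
          unfolding sum.cartesian_product by (intro sum.cong refl) (auto split: if_splits)
        also have "\<dots> = mat_coeff (X - Y) u v" using uv eigenbasis_finite[OF U] by simp
        finally show ?thesis using uv True by (simp add: mat_coeff_diff mat_coeff_multiplier[OF U])
      qed
    qed
  qed
  have spec: "{\<mu>. E \<mu> \<noteq> {0}} = (\<lambda>(u, v). K u v) ` (U \<times> U)"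
  proof (intro set_eqI iffI)
    fix \<mu> assume "\<mu> \<in> {\<mu>. E \<mu> \<noteq> {0}}"
    moreover have "0 \<in> E \<mu>" by (simp add: E)
    ultimately obtain X where X: "X \<in> E \<mu>" "X \<noteq> 0" by blast
    then have "\<not> (\<forall>u\<in>U. \<forall>v\<in>U. mat_coeff X u v = mat_coeff 0 u v)"
      using mat_coeff_eqI[OF U, of X 0] by blast
    then show "\<mu> \<in> (\<lambda>(u, v). K u v) ` (U \<times> U)" using X(1) by (fastforce simp: E)
  next
    fix \<mu> assume "\<mu> \<in> (\<lambda>(u, v). K u v) ` (U \<times> U)"
    then obtain a b where ab: "a \<in> U" "b \<in> U" "K a b = \<mu>" by auto
    let ?Z = "from_coeff U (\<lambda>w. if w = (a, b) then 1 else 0)"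
    have "?Z \<in> E \<mu>" using ab by (auto simp: E mat_coeff_from_coeff[OF U])
    moreover have "mat_coeff ?Z a b \<noteq> 0" using ab by (simp add: mat_coeff_from_coeff[OF U])
    then have "?Z \<noteq> 0" by (metis mat_coeff_zero)
    ultimately show "\<mu> \<in> {\<mu>. E \<mu> \<noteq> {0}}" by blast
  qed
  have "mat_coeff (fun_calc f (multiplier U K) X) u v
      = (\<Sum>\<mu>\<in>(\<lambda>(u, v). K u v) ` (U \<times> U). if \<mu> = K u v then of_real (f \<mu>) * mat_coeff X u v else 0)"
    unfolding fun_calc_def E_def[symmetric] spec mat_coeff_sum
    by (intro sum.cong refl) (auto simp: mat_coeff_mscale proj mat_coeff_multiplier[OF U uv])
  also have "\<dots> = of_real (f (K u v)) * mat_coeff X u v"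
    using uv eigenbasis_finite[OF U] by (subst sum.delta) auto
  finally show "mat_coeff (fun_calc f (multiplier U K) X) u v = of_real (f (K u v)) * mat_coeff X u v" .
qed

lemma J_op_multiplier:
  assumes D: "pos_def D" and U: "eigenbasis D U l"
  shows "J_op f D = multiplier U (\<lambda>u v. l v * f (l u / l v))"
proof -
  have pos: "l u \<noteq> 0" if "u \<in> U" for u using eigenbasis_pos[OF D U that] by simp
  have "L_op D \<circ> inv (R_op D) = multiplier U (\<lambda>u v. l u / l v)"
  proof (rule multiplier_eqI[OF U])
    fix X u v assume uv: "u \<in> U" "v \<in> U"
    have "inv (R_op D) = multiplier U (\<lambda>u v. inverse (l v))"
      unfolding R_op_multiplier[OF U] using pos by (intro multiplier_inverse[OF U]) auto
    moreover have "L_op D = multiplier U (\<lambda>u v. l u)"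
      using D by (intro L_op_multiplier[OF _ U]) (simp add: pos_def_def)
    ultimately show "mat_coeff ((L_op D \<circ> inv (R_op D)) X) u v = of_real (l u / l v) * mat_coeff X u v"
      using uv by (simp add: mat_coeff_multiplier[OF U] divide_inverse)
  qed
  then show ?thesis
    unfolding J_op_def
    by (intro multiplier_eqI[OF U])
       (simp add: fun_calc_multiplier[OF U] R_op_multiplier[OF U] mat_coeff_multiplier[OF U])
qed

section \<open>Schur-positive kernels\<close>

definition psd_array :: "'i set \<Rightarrow> ('i \<Rightarrow> 'i \<Rightarrow> complex) \<Rightarrow> bool" where
  "psd_array I A \<longleftrightarrow> (\<forall>c. (\<Sum>i\<in>I. \<Sum>j\<in>I. cnj (c i) * A i j * c j) \<in> \<real>\<^sub>\<ge>\<^sub>0)"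

text \<open>For a finite index set this is positive semidefiniteness of \<open>K\<close>, by the Schur product
  theorem. With positivity expressed through the action on positive arrays, closure under entrywise products
  is composition, and complete positivity of a multiplier is an instance.\<close>

definition schur_positive :: "'i set \<Rightarrow> ('i \<Rightarrow> 'i \<Rightarrow> real) \<Rightarrow> bool" where
  "schur_positive I K \<longleftrightarrow>
     (\<forall>A. psd_array I A \<longrightarrow> psd_array I (\<lambda>i j. complex_of_real (K i j) * A i j))"

lemma schur_positive_cong:
  assumes "schur_positive I K" "\<And>i j. i \<in> I \<Longrightarrow> j \<in> I \<Longrightarrow> K i j = K' i j"
  shows "schur_positive I K'"
proof -
  have "(\<Sum>i\<in>I. \<Sum>j\<in>I. cnj (c i) * (complex_of_real (K i j) * A i j) * c j)
      = (\<Sum>i\<in>I. \<Sum>j\<in>I. cnj (c i) * (complex_of_real (K' i j) * A i j) * c j)" for c A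
    by (intro sum.cong refl) (simp add: assms(2))
  with assms(1) show ?thesis
    by (simp add: schur_positive_def psd_array_def)
qed

lemma schur_positive_rank_one: "schur_positive I (\<lambda>i j. g i * g j)"
  unfolding schur_positive_def psd_array_def
proof (intro allI impI)
  fix A :: "'a \<Rightarrow> 'a \<Rightarrow> complex" and c :: "'a \<Rightarrow> complex"
  assume *: "\<forall>c. (\<Sum>i\<in>I. \<Sum>j\<in>I. cnj (c i) * A i j * c j) \<in> \<real>\<^sub>\<ge>\<^sub>0"
  have "(\<Sum>i\<in>I. \<Sum>j\<in>I. cnj (of_real (g i) * c i) * A i j * (of_real (g j) * c j)) \<in> \<real>\<^sub>\<ge>\<^sub>0"
    using *[rule_format, of "\<lambda>i. of_real (g i) * c i"] .
  then show "(\<Sum>i\<in>I. \<Sum>j\<in>I. cnj (c i) * (complex_of_real (g i * g j) * A i j) * c j) \<in> \<real>\<^sub>\<ge>\<^sub>0"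
    by (simp add: mult_ac)
qed

lemma schur_positive_add:
  assumes "schur_positive I K" "schur_positive I L"
  shows "schur_positive I (\<lambda>i j. K i j + L i j)"
  using assms unfolding schur_positive_def psd_array_def
  by (simp add: algebra_simps sum.distrib)

lemma schur_positive_mult:
  assumes "schur_positive I K" "schur_positive I L"
  shows "schur_positive I (\<lambda>i j. K i j * L i j)"
  unfolding schur_positive_def
proof (intro allI impI)
  fix A assume "psd_array I A"
  then have "psd_array I (\<lambda>i j. complex_of_real (K i j) * (complex_of_real (L i j) * A i j))"
    using assms unfolding schur_positive_def by blast
  then show "psd_array I (\<lambda>i j. complex_of_real (K i j * L i j) * A i j)"
    by (simp add: mult.assoc)
qed

lemma schur_positive_const: "0 \<le> c \<Longrightarrow> schur_positive I (\<lambda>i j. c)"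
  using schur_positive_rank_one[of I "\<lambda>_. sqrt c"] by simp

lemma schur_positive_power:
  assumes "schur_positive I K"
  shows "schur_positive I (\<lambda>i j. K i j ^ n)"
  by (induction n) (simp_all add: schur_positive_const schur_positive_mult assms)

lemma schur_positive_sum:
  assumes "\<And>n. n \<in> N \<Longrightarrow> schur_positive I (K n)"
  shows "schur_positive I (\<lambda>i j. \<Sum>n\<in>N. K n i j)"
  using assms
  by (induction N rule: infinite_finite_induct)
     (simp_all add: schur_positive_const schur_positive_add)

lemma schur_positive_limit:
  assumes "\<And>n. schur_positive I (K n)"
    and "\<And>i j. i \<in> I \<Longrightarrow> j \<in> I \<Longrightarrow> (\<lambda>n. K n i j) \<longlonglongrightarrow> L i j"
  shows "schur_positive I L"
  unfolding schur_positive_def psd_array_def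
proof (intro allI impI)
  fix A :: "'a \<Rightarrow> 'a \<Rightarrow> complex" and c :: "'a \<Rightarrow> complex"
  assume "\<forall>c. (\<Sum>i\<in>I. \<Sum>j\<in>I. cnj (c i) * A i j * c j) \<in> \<real>\<^sub>\<ge>\<^sub>0"
  then have mem: "(\<Sum>i\<in>I. \<Sum>j\<in>I. cnj (c i) * (complex_of_real (K n i j) * A i j) * c j) \<in> \<real>\<^sub>\<ge>\<^sub>0" for n
    using assms(1)[of n] by (simp add: schur_positive_def psd_array_def)
  have "(\<lambda>n. \<Sum>i\<in>I. \<Sum>j\<in>I. cnj (c i) * (complex_of_real (K n i j) * A i j) * c j)
      \<longlonglongrightarrow> (\<Sum>i\<in>I. \<Sum>j\<in>I. cnj (c i) * (complex_of_real (L i j) * A i j) * c j)"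
    by (intro tendsto_sum tendsto_intros assms(2))
  then show "(\<Sum>i\<in>I. \<Sum>j\<in>I. cnj (c i) * (complex_of_real (L i j) * A i j) * c j) \<in> \<real>\<^sub>\<ge>\<^sub>0"
    by (rule Lim_in_closed_set[OF closed_nonneg_Reals_complex always_eventually, rotated 2])
       (use mem in auto)
qed

lemma binomial_series_negative_exponent:
  fixes s t :: real
  assumes "0 \<le> t" "t < 1"
  shows "(\<lambda>n. pochhammer s n / fact n * t ^ n) sums (1 - t) powr (-s)"
proof -
  have "(\<lambda>n. ((-s) gchoose n) * (-t) ^ n) sums (1 + (-t)) powr (-s)"
    using assms by (intro gen_binomial_real) auto
  moreover have "((-s) gchoose n) * (-t) ^ n = pochhammer s n / fact n * t ^ n" for n
    by (simp add: gbinomial_pochhammer power_minus[of t] flip: power_add)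
  ultimately show ?thesis by simp
qed

text \<open>Since \<open>(x + 1) (y + 1) = (x + y) + (x y + 1)\<close>, one has \<open>x + y - P = (x + 1) (y
  + 1) (1 - t)\<close> with \<open>t = (x y + 1 + P) / ((x + 1) (y + 1))\<close> Schur positive and \<open>0
  \<le> t < 1\<close>. The binomial series of \<open>(1 - t) powr (-s)\<close> has nonnegative coefficients,
  so all negative powers are Schur positive at once.\<close>

lemma schur_positive_sum_minus_powr:
  fixes x :: "'i \<Rightarrow> real"
  assumes x: "\<And>i. i \<in> I \<Longrightarrow> 0 < x i"
    and P: "schur_positive I P"
    and P0: "\<And>i j. i \<in> I \<Longrightarrow> j \<in> I \<Longrightarrow> 0 \<le> P i j"
    and lt: "\<And>i j. i \<in> I \<Longrightarrow> j \<in> I \<Longrightarrow> P i j < x i + x j"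
    and s: "0 < s"
  shows "schur_positive I (\<lambda>i j. (x i + x j - P i j) powr (-s))"
proof -
  define t where "t i j = (x i * x j + 1 + P i j) * ((1 / (x i + 1)) * (1 / (x j + 1)))" for i j
  have t0: "0 \<le> t i j" "t i j < 1" if "i \<in> I" "j \<in> I" for i j
  proof -
    have pos: "0 < x i" "0 < x j" using that x by auto
    have "0 < (x i + 1) * (x j + 1)" using pos by simp
    moreover have "x i * x j + 1 + P i j < (x i + 1) * (x j + 1)"
      using lt[OF that] by (simp add: algebra_simps)
    moreover have "t i j = (x i * x j + 1 + P i j) / ((x i + 1) * (x j + 1))"
      by (simp add: t_def)
    ultimately show "t i j < 1" by (simp only: divide_less_eq_1) simp
    show "0 \<le> t i j"
      using pos P0[OF that] by (simp add: t_def)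
  qed
  have t: "schur_positive I t"
    unfolding t_def
    by (intro schur_positive_mult schur_positive_add schur_positive_rank_one
          schur_positive_const P) simp
  have "schur_positive I (\<lambda>i j. (1 - t i j) powr (-s))"
  proof (rule schur_positive_limit)
    show "schur_positive I (\<lambda>i j. \<Sum>n<N. pochhammer s n / fact n * t i j ^ n)" for N
      using s by (intro schur_positive_sum schur_positive_mult schur_positive_power t
          schur_positive_const) (auto intro!: divide_nonneg_nonneg pochhammer_nonneg)
    show "(\<lambda>N. \<Sum>n<N. pochhammer s n / fact n * t i j ^ n) \<longlonglongrightarrow> (1 - t i j) powr (-s)"
      if "i \<in> I" "j \<in> I" for i j
      using binomial_series_negative_exponent[OF t0[OF that]] by (simp add: sums_def)
  qed
  then have "schur_positive I (\<lambda>i j. ((x i + 1) powr (-s) * (x j + 1) powr (-s)) * (1 - t i j) powr (-s))"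
    by (intro schur_positive_mult schur_positive_rank_one)
  then show ?thesis
  proof (rule schur_positive_cong)
    fix i j assume ij: "i \<in> I" "j \<in> I"
    have pos: "0 < x i + 1" "0 < x j + 1" using x[OF ij(1)] x[OF ij(2)] by auto
    have "(x i + 1) * (x j + 1) * t i j = x i * x j + 1 + P i j"
      using pos by (simp add: t_def)
    then have "x i + x j - P i j = (x i + 1) * (x j + 1) * (1 - t i j)"
      by (simp add: algebra_simps)
    then show "(x i + 1) powr (-s) * (x j + 1) powr (-s) * (1 - t i j) powr (-s)
        = (x i + x j - P i j) powr (-s)"
      using pos t0[OF ij] by (simp add: powr_mult)
  qed
qed

text \<open>\<open>power_quotient n x y\<close> is \<open>(x ^ n - y ^ n) / (x - y)\<close> in division-free
  form, hence also correct on the diagonal.\<close>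

fun power_quotient :: "nat \<Rightarrow> real \<Rightarrow> real \<Rightarrow> real" where
  "power_quotient 0 x y = 0"
| "power_quotient (Suc n) x y = x ^ n + y * power_quotient n x y"

lemma power_quotient_mult: "(x - y) * power_quotient n x y = x ^ n - y ^ n"
proof (induction n)
  case (Suc n)
  have "(x - y) * power_quotient (Suc n) x y = (x - y) * x ^ n + y * ((x - y) * power_quotient n x y)"
    by (simp add: algebra_simps)
  also have "\<dots> = x ^ Suc n - y ^ Suc n"
    unfolding Suc by (simp add: algebra_simps)
  finally show ?case .
qed simp

lemma power_quotient_diag: "power_quotient n x x = real n * x ^ (n - 1)"
proof (induction n)
  case (Suc n)
  then show ?case by (cases n) (auto simp: algebra_simps)
qed simp

lemma power_quotient_nonneg: "0 \<le> x \<Longrightarrow> 0 \<le> y \<Longrightarrow> 0 \<le> power_quotient n x y"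
  by (induction n) auto

lemma power_quotient_pos: "0 < x \<Longrightarrow> 0 < y \<Longrightarrow> 0 < n \<Longrightarrow> 0 < power_quotient n x y"
  by (cases n) (auto intro!: add_pos_nonneg mult_nonneg_nonneg power_quotient_nonneg)

text \<open>Dividing by the middle term shows that the ratio \<open>r\<^sub>n\<close> of consecutive quotients
  satisfies \<open>1 / r\<^sub>n\<^sub>+\<^sub>1 = x + y - x y r\<^sub>n\<close>.\<close>

lemma power_quotient_recurrence:
  "power_quotient (Suc (Suc n)) x y
     = (x + y) * power_quotient (Suc n) x y - x * y * power_quotient n x y"
  by (simp add: algebra_simps)

text \<open>The recurrence turns positivity of one ratio into positivity of all powers of the reciprocal of
  \<open>x + y - x y r\<close>, which is the next ratio. The induction step consumes only the first power and
  produces all of them.\<close>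

lemma schur_positive_consecutive_powr:
  fixes x :: "'i \<Rightarrow> real"
  assumes x: "\<And>i. i \<in> I \<Longrightarrow> 0 < x i"
    and s: "0 < s"
  shows "schur_positive I
    (\<lambda>i j. (power_quotient n (x i) (x j) / power_quotient (Suc n) (x i) (x j)) powr s)"
  using s
proof (induction n arbitrary: s)
  case 0
  then show ?case by (simp add: schur_positive_const)
next
  case (Suc n)
  define r where "r i j = power_quotient n (x i) (x j) / power_quotient (Suc n) (x i) (x j)" for i j
  have r0: "0 \<le> r i j" if "i \<in> I" "j \<in> I" for i j
    using x that unfolding r_def
    by (intro divide_nonneg_nonneg power_quotient_nonneg) (auto intro: less_imp_le)
  have eq: "power_quotient (Suc n) (x i) (x j) / power_quotient (Suc (Suc n)) (x i) (x j)
      = inverse (x i + x j - x i * x j * r i j)"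
    and pos: "0 < x i + x j - x i * x j * r i j"
    if "i \<in> I" "j \<in> I" for i j
  proof -
    have p: "0 < power_quotient (Suc n) (x i) (x j)" "0 < power_quotient (Suc (Suc n)) (x i) (x j)"
      using x that by (auto simp only: intro!: power_quotient_pos)
    have e: "x i + x j - x i * x j * r i j
        = power_quotient (Suc (Suc n)) (x i) (x j) / power_quotient (Suc n) (x i) (x j)"
      using p(1) unfolding r_def power_quotient_recurrence
      by (simp add: field_simps del: power_quotient.simps)
    show "power_quotient (Suc n) (x i) (x j) / power_quotient (Suc (Suc n)) (x i) (x j)
      = inverse (x i + x j - x i * x j * r i j)"
      unfolding e by (simp del: power_quotient.simps)
    show "0 < x i + x j - x i * x j * r i j"
      unfolding e using p by (intro divide_pos_pos)
  qed
  have "schur_positive I (\<lambda>i j. r i j powr 1)"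
    using Suc.IH[OF zero_less_one] by (simp only: r_def)
  then have "schur_positive I r"
    by (rule schur_positive_cong) (use r0 in auto)
  then have "schur_positive I (\<lambda>i j. x i * x j * r i j)"
    by (intro schur_positive_mult schur_positive_rank_one)
  then have "schur_positive I (\<lambda>i j. (x i + x j - x i * x j * r i j) powr (-s))"
    using x r0 pos Suc.prems
    by (intro schur_positive_sum_minus_powr) (auto simp: less_imp_le)
  then show ?case
  proof (rule schur_positive_cong)
    fix i j assume ij: "i \<in> I" "j \<in> I"
    show "(x i + x j - x i * x j * r i j) powr (-s) =
      (power_quotient (Suc n) (x i) (x j) / power_quotient (Suc (Suc n)) (x i) (x j)) powr s"
      using pos[OF ij] unfolding eq[OF ij] by (simp add: powr_minus inverse_powr less_imp_le)
  qed
qed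

text \<open>The ratio of two quotients telescopes into ratios of consecutive ones.\<close>

lemma schur_positive_power_quotient_powr:
  fixes x :: "'i \<Rightarrow> real"
  assumes x: "\<And>i. i \<in> I \<Longrightarrow> 0 < x i"
    and s: "0 < s" and a: "0 < a" and ab: "a \<le> b"
  shows "schur_positive I
    (\<lambda>i j. (power_quotient a (x i) (x j) / power_quotient b (x i) (x j)) powr s)"
  using ab
proof (induction b rule: dec_induct)
  case base
  have "schur_positive I (\<lambda>i j. 1)" by (simp add: schur_positive_const)
  then show ?case
  proof (rule schur_positive_cong)
    fix i j assume "i \<in> I" "j \<in> I"
    then have "0 < power_quotient a (x i) (x j)" using x a by (intro power_quotient_pos) auto
    then show "1 = (power_quotient a (x i) (x j) / power_quotient a (x i) (x j)) powr s" by simp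
  qed
next
  case (step b)
  have "schur_positive I
    (\<lambda>i j. (power_quotient a (x i) (x j) / power_quotient b (x i) (x j)) powr s *
       (power_quotient b (x i) (x j) / power_quotient (Suc b) (x i) (x j)) powr s)"
    by (intro schur_positive_mult step.IH schur_positive_consecutive_powr x s)
  then show ?case
  proof (rule schur_positive_cong)
    fix i j assume ij: "i \<in> I" "j \<in> I"
    have p: "0 < power_quotient n (x i) (x j)" if "0 < n" for n
      using x ij that by (intro power_quotient_pos) auto
    have b: "0 < b" using a step.hyps by simp
    show "(power_quotient a (x i) (x j) / power_quotient b (x i) (x j)) powr s *
       (power_quotient b (x i) (x j) / power_quotient (Suc b) (x i) (x j)) powr s
      = (power_quotient a (x i) (x j) / power_quotient (Suc b) (x i) (x j)) powr s"
      using p[OF a] p[OF b] p[of "Suc b"]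
      by (simp add: powr_mult[symmetric] del: power_quotient.simps)
  qed
qed

section \<open>Dominated weights\<close>

text \<open>A weight \<open>m\<close> on a set of points induces diagonal quadratic forms on
  \<open>J\<close>-tuples and on \<open>I\<close>-tuples, the points being attached to the indices by
  \<open>\<eta>\<close> and \<open>\<xi>\<close>. A positive weight is dominated if the map \<open>B\<close>
  does not increase the form. In the application \<open>B\<close> is the adjoint of the channel written in
  eigenbases, and the points are the pairs of eigenvalues of \<open>D\<close> and of its image; in this way
  one function \<open>m\<close> describes the operators of both matrices.\<close>

locale weight_domination =
  fixes I :: "'i set" and \<xi> :: "'i \<Rightarrow> 's" and J :: "'j set" and \<eta> :: "'j \<Rightarrow> 's"
    and B :: "('j \<Rightarrow> complex) \<Rightarrow> 'i \<Rightarrow> complex"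
  assumes B_add: "i \<in> I \<Longrightarrow> B (\<lambda>j. y j + z j) i = B y i + B z i"
begin

definition pts :: "'s set" where
  "pts = \<xi> ` I \<union> \<eta> ` J"

definition dominated :: "('s \<Rightarrow> real) \<Rightarrow> bool" where
  "dominated m \<longleftrightarrow> (\<forall>s\<in>pts. 0 < m s) \<and>
     (\<forall>y. (\<Sum>i\<in>I. m (\<xi> i) * (cmod (B y i))\<^sup>2) \<le> (\<Sum>j\<in>J. m (\<eta> j) * (cmod (y j))\<^sup>2))"

lemma dominated_pos: "dominated m \<Longrightarrow> s \<in> pts \<Longrightarrow> 0 < m s"
  by (simp add: dominated_def)

lemma dominated_cong:
  assumes "dominated m" "\<And>s. s \<in> pts \<Longrightarrow> m s = m' s"
  shows "dominated m'"
proof -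
  have "(\<Sum>i\<in>I. m' (\<xi> i) * (cmod (B y i))\<^sup>2) = (\<Sum>i\<in>I. m (\<xi> i) * (cmod (B y i))\<^sup>2)"
       "(\<Sum>j\<in>J. m' (\<eta> j) * (cmod (y j))\<^sup>2) = (\<Sum>j\<in>J. m (\<eta> j) * (cmod (y j))\<^sup>2)" for y
    by (intro sum.cong refl; simp add: assms(2) pts_def)+
  with assms show ?thesis by (simp add: dominated_def)
qed

lemma dominated_scale: "dominated m \<Longrightarrow> 0 < c \<Longrightarrow> dominated (\<lambda>s. c * m s)"
  by (simp add: dominated_def mult.assoc flip: sum_distrib_left)

lemma dominated_add: "dominated m \<Longrightarrow> dominated m' \<Longrightarrow> dominated (\<lambda>s. m s + m' s)"
  by (simp add: dominated_def distrib_right sum.distrib add_pos_pos add_mono)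

lemma dominated_sum:
  assumes "finite N" "N \<noteq> {}" "\<And>n. n \<in> N \<Longrightarrow> dominated (m n)"
  shows "dominated (\<lambda>s. \<Sum>n\<in>N. m n s)"
  using assms by (induction N rule: finite_ne_induct) (simp_all add: dominated_add)

text \<open>The gap, after multiplication by \<open>a + b\<close>, is at least \<open>(a |z| - b
  |w|)\<^sup>2\<close>.\<close>

lemma parallel_sum_le:
  fixes a b :: real and z w :: complex
  assumes "0 < a" "0 < b"
  shows "a * b / (a + b) * (cmod (z + w))\<^sup>2 \<le> a * (cmod z)\<^sup>2 + b * (cmod w)\<^sup>2"
proof -
  have "(cmod (z + w))\<^sup>2 \<le> (cmod z + cmod w)\<^sup>2"
    by (simp add: norm_triangle_ineq power_mono)
  then have "a * b / (a + b) * (cmod (z + w))\<^sup>2 \<le> a * b / (a + b) * (cmod z + cmod w)\<^sup>2"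
    using assms by (intro mult_left_mono) auto
  also have "\<dots> \<le> a * (cmod z)\<^sup>2 + b * (cmod w)\<^sup>2"
  proof -
    have "(a * (cmod z)\<^sup>2 + b * (cmod w)\<^sup>2) * (a + b) - a * b * (cmod z + cmod w)\<^sup>2
        = (a * cmod z - b * cmod w)\<^sup>2"
      by (simp add: power2_eq_square algebra_simps)
    then have "a * b * (cmod z + cmod w)\<^sup>2 \<le> (a * (cmod z)\<^sup>2 + b * (cmod w)\<^sup>2) * (a + b)"
      by (metis diff_ge_0_iff_ge zero_le_power2)
    then show ?thesis using assms by (simp add: pos_divide_le_eq)
  qed
  finally show ?thesis .
qed

text \<open>The parallel sum has the form \<open>min {m |y\<^sub>1|\<^sup>2 + m' |y\<^sub>2|\<^sup>2 |
  y\<^sub>1 + y\<^sub>2 = y}\<close>. Splitting a tuple optimally on the side of \<open>J\<close> and pushing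
  both parts through \<open>B\<close> gives an admissible, possibly suboptimal, splitting on the side of
  \<open>I\<close>.\<close>

lemma dominated_parallel:
  assumes m: "dominated m" and m': "dominated m'"
  shows "dominated (\<lambda>s. m s * m' s / (m s + m' s))"
  unfolding dominated_def
proof (intro conjI ballI allI)
  show "0 < m s * m' s / (m s + m' s)" if "s \<in> pts" for s
    using dominated_pos[OF m that] dominated_pos[OF m' that] by (simp add: add_pos_pos)
  fix y :: "'j \<Rightarrow> complex"
  define y1 where "y1 j = of_real (m' (\<eta> j) / (m (\<eta> j) + m' (\<eta> j))) * y j" for j
  define y2 where "y2 j = y j - y1 j" for j
  have y: "y = (\<lambda>j. y1 j + y2 j)" by (simp add: y2_def)
  have "(\<Sum>i\<in>I. m (\<xi> i) * m' (\<xi> i) / (m (\<xi> i) + m' (\<xi> i)) * (cmod (B y i))\<^sup>2)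
      \<le> (\<Sum>i\<in>I. m (\<xi> i) * (cmod (B y1 i))\<^sup>2 + m' (\<xi> i) * (cmod (B y2 i))\<^sup>2)"
  proof (intro sum_mono)
    fix i assume i: "i \<in> I"
    then have "B y i = B y1 i + B y2 i" by (subst y) (rule B_add)
    moreover have "\<xi> i \<in> pts" using i by (simp add: pts_def)
    ultimately show "m (\<xi> i) * m' (\<xi> i) / (m (\<xi> i) + m' (\<xi> i)) * (cmod (B y i))\<^sup>2
       \<le> m (\<xi> i) * (cmod (B y1 i))\<^sup>2 + m' (\<xi> i) * (cmod (B y2 i))\<^sup>2"
      using parallel_sum_le dominated_pos m m' by auto
  qed
  also have "\<dots> \<le> (\<Sum>j\<in>J. m (\<eta> j) * (cmod (y1 j))\<^sup>2 + m' (\<eta> j) * (cmod (y2 j))\<^sup>2)"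
    using m m' by (simp add: sum.distrib dominated_def add_mono)
  also have "\<dots> = (\<Sum>j\<in>J. m (\<eta> j) * m' (\<eta> j) / (m (\<eta> j) + m' (\<eta> j)) * (cmod (y j))\<^sup>2)"
  proof (intro sum.cong refl)
    fix j assume "j \<in> J"
    then have j: "\<eta> j \<in> pts" by (simp add: pts_def)
    define a b where "a = m (\<eta> j)" and "b = m' (\<eta> j)"
    have ab: "0 < a" "0 < b" using j m m' dominated_pos by (auto simp: a_def b_def)
    have y2: "y2 j = of_real (a / (a + b)) * y j"
    proof -
      have "y2 j = of_real (1 - b / (a + b)) * y j"
        by (simp add: y2_def y1_def a_def b_def algebra_simps)
      also have "1 - b / (a + b) = a / (a + b)" using ab by (simp add: field_simps)
      finally show ?thesis .
    qed
    have "a * (b / (a + b))\<^sup>2 + b * (a / (a + b))\<^sup>2 = (a * b * (a + b)) / (a + b)\<^sup>2"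
      by (simp add: power_divide add_divide_distrib[symmetric]) (simp add: power2_eq_square algebra_simps)
    also have "\<dots> = a * b / (a + b)" using ab by (simp add: power2_eq_square)
    finally have e: "a * (b / (a + b))\<^sup>2 + b * (a / (a + b))\<^sup>2 = a * b / (a + b)" .
    have "m (\<eta> j) * (cmod (y1 j))\<^sup>2 + m' (\<eta> j) * (cmod (y2 j))\<^sup>2
        = (a * (b / (a + b))\<^sup>2 + b * (a / (a + b))\<^sup>2) * (cmod (y j))\<^sup>2"
      unfolding y2 using ab
      by (simp add: y1_def norm_mult norm_divide power_mult_distrib power_divide
          flip: a_def b_def of_real_add) (simp add: algebra_simps)
    then show "m (\<eta> j) * (cmod (y1 j))\<^sup>2 + m' (\<eta> j) * (cmod (y2 j))\<^sup>2
       = m (\<eta> j) * m' (\<eta> j) / (m (\<eta> j) + m' (\<eta> j)) * (cmod (y j))\<^sup>2"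
      unfolding e by (simp add: a_def b_def)
  qed
  finally show "(\<Sum>i\<in>I. m (\<xi> i) * m' (\<xi> i) / (m (\<xi> i) + m' (\<xi> i)) * (cmod (B y i))\<^sup>2)
     \<le> (\<Sum>j\<in>J. m (\<eta> j) * m' (\<eta> j) / (m (\<eta> j) + m' (\<eta> j)) * (cmod (y j))\<^sup>2)" .
qed

lemma dominated_harmonic_sum:
  assumes "finite N" "N \<noteq> {}" "\<And>n. n \<in> N \<Longrightarrow> dominated (m n)"
  shows "dominated (\<lambda>s. inverse (\<Sum>n\<in>N. inverse (m n s)))"
  using assms
proof (induction N rule: finite_ne_induct)
  case (insert n N)
  let ?h = "\<lambda>s. inverse (\<Sum>n\<in>N. inverse (m n s))"
  have h: "dominated ?h" and n: "dominated (m n)" using insert by auto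
  show ?case
  proof (rule dominated_cong[OF dominated_parallel[OF n h]])
    fix s assume "s \<in> pts"
    then have "0 < m n s" "0 < ?h s" using dominated_pos n h by blast+
    then show "m n s * ?h s / (m n s + ?h s) = inverse (\<Sum>n\<in>insert n N. inverse (m n s))"
      using insert.hyps by (simp add: field_simps)
  qed
qed simp

lemma dominated_limit:
  assumes "\<And>n. dominated (m n)" "\<And>s. s \<in> pts \<Longrightarrow> (\<lambda>n. m n s) \<longlonglongrightarrow> l s"
    and "\<And>s. s \<in> pts \<Longrightarrow> 0 < l s"
  shows "dominated l"
  unfolding dominated_def
proof (intro conjI ballI allI)
  fix y :: "'j \<Rightarrow> complex"
  show "(\<Sum>i\<in>I. l (\<xi> i) * (cmod (B y i))\<^sup>2) \<le> (\<Sum>j\<in>J. l (\<eta> j) * (cmod (y j))\<^sup>2)"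
  proof (rule LIMSEQ_le)
    show "(\<lambda>n. \<Sum>i\<in>I. m n (\<xi> i) * (cmod (B y i))\<^sup>2) \<longlonglongrightarrow> (\<Sum>i\<in>I. l (\<xi> i) * (cmod (B y i))\<^sup>2)"
      by (intro tendsto_sum tendsto_intros assms(2)) (simp add: pts_def)
    show "(\<lambda>n. \<Sum>j\<in>J. m n (\<eta> j) * (cmod (y j))\<^sup>2) \<longlonglongrightarrow> (\<Sum>j\<in>J. l (\<eta> j) * (cmod (y j))\<^sup>2)"
      by (intro tendsto_sum tendsto_intros assms(2)) (simp add: pts_def)
  qed (use assms(1) in \<open>auto simp: dominated_def\<close>)
qed (use assms(3) in auto)

end

text \<open>Iterating the arithmetic and the harmonic mean converges to the geometric mean: the product of the
  two entries is invariant, and their distance at least halves in each step. This reduces the geometric mean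
  to addition, scaling, parallel sums and limits.\<close>

fun arith_harm :: "real \<Rightarrow> real \<Rightarrow> nat \<Rightarrow> real \<times> real" where
  "arith_harm a b 0 = (a, b)"
| "arith_harm a b (Suc n) =
    (let (u, v) = arith_harm a b n in ((u + v) / 2, 2 * (u * v / (u + v))))"

lemma arith_harm_invariant:
  assumes "0 < a" "0 < b"
  shows "0 < fst (arith_harm a b n)" "0 < snd (arith_harm a b n)"
    "fst (arith_harm a b n) * snd (arith_harm a b n) = a * b"
proof (induction n)
  case (Suc n)
  { case 1 then show ?case using Suc by (auto simp: Let_def case_prod_beta) }
  { case 2 then show ?case using Suc assms by (auto simp: Let_def case_prod_beta add_pos_pos) }
  { case 3
    have "fst (arith_harm a b n) + snd (arith_harm a b n) \<noteq> 0" using Suc(1,2) by linarith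
    then show ?case using Suc(3) by (simp add: Let_def case_prod_beta) }
qed (use assms in auto)

lemma arith_harm_gap:
  assumes "0 < a" "0 < b"
  shows "\<bar>fst (arith_harm a b n) - snd (arith_harm a b n)\<bar> \<le> \<bar>a - b\<bar> / 2 ^ n"
proof (induction n)
  case (Suc n)
  define u v where "u = fst (arith_harm a b n)" and "v = snd (arith_harm a b n)"
  have uv: "0 < u" "0 < v" using arith_harm_invariant[OF assms] by (auto simp: u_def v_def)
  have "(u + v) / 2 - 2 * (u * v / (u + v)) = (u - v)\<^sup>2 / (2 * (u + v))"
    using uv by (simp add: field_simps power2_eq_square)
  then have "\<bar>(u + v) / 2 - 2 * (u * v / (u + v))\<bar> = \<bar>u - v\<bar> * \<bar>u - v\<bar> / (2 * (u + v))"
    using uv by (simp add: power2_eq_square abs_mult)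
  also have "\<dots> \<le> \<bar>u - v\<bar> * (u + v) / (2 * (u + v))"
    using uv by (intro divide_right_mono mult_left_mono) auto
  also have "\<dots> = \<bar>u - v\<bar> / 2"
  proof -
    have "t * w / (2 * w) = t / 2" if "w > 0" for t w :: real using that by simp
    from this[of "u + v"] show ?thesis using uv by simp
  qed
  also have "\<dots> \<le> \<bar>a - b\<bar> / 2 ^ n / 2" using Suc by (simp add: u_def v_def divide_right_mono)
  finally show ?case by (simp add: Let_def case_prod_beta u_def v_def mult.commute)
qed simp

lemma arith_harm_tendsto:
  assumes "0 < a" "0 < b"
  shows "(\<lambda>n. fst (arith_harm a b n)) \<longlonglongrightarrow> sqrt (a * b)"
proof -
  let ?u = "\<lambda>n. fst (arith_harm a b n)" and ?v = "\<lambda>n. snd (arith_harm a b n)"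
  have gap: "\<bar>?u n - sqrt (a * b)\<bar> \<le> \<bar>a - b\<bar> / 2 ^ n" for n
  proof -
    have pos: "0 < ?u n" "0 < ?v n" and ab: "?u n * ?v n = a * b"
      using arith_harm_invariant[OF assms] by auto
    have s: "sqrt (a * b) = sqrt (?u n) * sqrt (?v n)" by (simp add: real_sqrt_mult flip: ab)
    have "\<bar>?u n - sqrt (a * b)\<bar> \<le> \<bar>?u n - ?v n\<bar>"
    proof (cases "?u n \<le> ?v n")
      case True
      have "?u n * ?u n \<le> a * b" "a * b \<le> ?v n * ?v n"
        using True pos by (auto simp flip: ab)
      then have "?u n \<le> sqrt (a * b)" "sqrt (a * b) \<le> ?v n"
        using pos by (auto intro!: real_le_rsqrt real_le_lsqrt simp: power2_eq_square)
      then show ?thesis by simp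
    next
      case False
      have "?v n * ?v n \<le> a * b" "a * b \<le> ?u n * ?u n"
        using False pos by (auto simp flip: ab)
      then have "?v n \<le> sqrt (a * b)" "sqrt (a * b) \<le> ?u n"
        using pos by (auto intro!: real_le_rsqrt real_le_lsqrt simp: power2_eq_square)
      then show ?thesis by simp
    qed
    then show ?thesis using arith_harm_gap[OF assms, of n] by linarith
  qed
  have "(\<lambda>n. \<bar>a - b\<bar> * (1 / 2) ^ n) \<longlonglongrightarrow> \<bar>a - b\<bar> * 0"
    by (intro tendsto_mult LIMSEQ_power_zero tendsto_const) auto
  then have "(\<lambda>n. \<bar>a - b\<bar> / 2 ^ n) \<longlonglongrightarrow> 0" by (simp add: power_divide)
  then have "(\<lambda>n. ?u n - sqrt (a * b)) \<longlonglongrightarrow> 0"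
    by (rule Lim_null_comparison[rotated]) (use gap in auto)
  then show ?thesis by (simp add: LIM_zero_iff)
qed

text \<open>Midpoints generate all dyadic rationals, which are dense.\<close>

lemma midpoint_closed_contains_interval:
  fixes T :: "real set"
  assumes "closed T" "0 \<in> T" "1 \<in> T"
    and mid: "\<And>a b. a \<in> T \<Longrightarrow> b \<in> T \<Longrightarrow> (a + b) / 2 \<in> T"
  shows "{0..1} \<subseteq> T"
proof -
  have dyadic: "real k / 2 ^ n \<in> T" if "k \<le> 2 ^ n" for k n
    using that
  proof (induction n arbitrary: k)
    case 0
    then show ?case using assms(2,3) by (cases k) auto
  next
    case (Suc n)
    define a where "a = k div 2"
    define b where "b = k - a"
    have "a \<le> 2 ^ n" "b \<le> 2 ^ n" "k = a + b" using Suc.prems by (auto simp: a_def b_def)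
    moreover have "real (a + b) / 2 ^ Suc n = (real a / 2 ^ n + real b / 2 ^ n) / 2"
      by (simp add: field_simps)
    ultimately show ?case using Suc.IH mid by metis
  qed
  show ?thesis
  proof
    fix s :: real assume s: "s \<in> {0..1}"
    have lim: "(\<lambda>n. real (nat \<lfloor>s * 2 ^ n\<rfloor>) / 2 ^ n) \<longlonglongrightarrow> s"
    proof -
      have b: "\<bar>real (nat \<lfloor>s * 2 ^ n\<rfloor>) / 2 ^ n - s\<bar> \<le> (1/2) ^ n" for n
      proof -
        have "real (nat \<lfloor>s * 2 ^ n\<rfloor>) = of_int \<lfloor>s * 2 ^ n\<rfloor>" using s by simp
        then have "\<bar>real (nat \<lfloor>s * 2 ^ n\<rfloor>) - s * 2 ^ n\<bar> \<le> 1" by linarith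
        then have "\<bar>real (nat \<lfloor>s * 2 ^ n\<rfloor>) - s * 2 ^ n\<bar> / 2 ^ n \<le> 1 / 2 ^ n"
          by (rule divide_right_mono) simp
        moreover have "\<bar>real (nat \<lfloor>s * 2 ^ n\<rfloor>) - s * 2 ^ n\<bar> / 2 ^ n
            = \<bar>real (nat \<lfloor>s * 2 ^ n\<rfloor>) / 2 ^ n - s\<bar>"
        proof -
          have "\<bar>t - s * d\<bar> / d = \<bar>t / d - s\<bar>" if "d > 0" for t d :: real
          proof -
            have "t / d - s = (t - s * d) / d" using that by (simp add: field_simps)
            then show ?thesis using that by simp
          qed
          from this[of "2 ^ n"] show ?thesis by simp
        qed
        ultimately show ?thesis by (simp add: power_divide)
      qed
      have "(\<lambda>n. (1 / 2 :: real) ^ n) \<longlonglongrightarrow> 0" by (intro LIMSEQ_power_zero) auto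
      then have "(\<lambda>n. real (nat \<lfloor>s * 2 ^ n\<rfloor>) / 2 ^ n - s) \<longlonglongrightarrow> 0"
        by (rule Lim_null_comparison[rotated]) (use b in auto)
      then show ?thesis by (simp add: LIM_zero_iff)
    qed
    have "real (nat \<lfloor>s * 2 ^ n\<rfloor>) / 2 ^ n \<in> T" for n
    proof (rule dyadic)
      have "s * 2 ^ n \<le> 2 ^ n" using s mult_right_mono[of s 1 "2 ^ n"] by simp
      then have "s * 2 ^ n < 2 ^ n + 1" by linarith
      then have "\<lfloor>s * 2 ^ n\<rfloor> \<le> 2 ^ n" by (simp add: floor_le_iff)
      then show "nat \<lfloor>s * 2 ^ n\<rfloor> \<le> 2 ^ n" by (simp add: nat_le_iff)
    qed
    then show "s \<in> T"
      by (rule closed_sequentially[OF assms(1) _ lim])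
  qed
qed

text \<open>The number \<open>c powr (1 / r)\<close> is the fixed point of \<open>t \<mapsto> c * t powr (1 -
  r)\<close>, and on a logarithmic scale the map contracts towards it by the factor \<open>1 -
  r\<close>.\<close>

lemma powr_geometric_iteration_tendsto:
  fixes c x :: real
  assumes "0 < c" "0 < x" "0 < r" "r < 1" 
    and S: "S 0 = x" "\<And>n. S (Suc n) = c * S n powr (1 - r)"
  shows "S \<longlonglongrightarrow> c powr (1 / r)"
proof -
  define d where "d = x / c powr (1 / r)"
  have d: "0 < d" using assms by (simp add: d_def)
  have S_eq: "S n = c powr (1 / r) * d powr ((1 - r) ^ n)" for n
  proof (induction n)
    case 0
    then show ?case using assms d by (simp add: d_def)
  next
    case (Suc n)
    have "S (Suc n) = c powr 1 * c powr ((1 / r) * (1 - r)) * d powr ((1 - r) ^ n * (1 - r))"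
      using assms d by (simp add: Suc S(2) powr_mult powr_powr)
    also have "c powr 1 * c powr ((1 / r) * (1 - r)) = c powr (1 / r)"
    proof -
      have "1 + (1 / r) * (1 - r) = 1 / r" using \<open>0 < r\<close> by (simp add: field_simps)
      then show ?thesis by (metis powr_add)
    qed
    finally show ?case by (simp add: mult.commute)
  qed
  have "(\<lambda>n. c powr (1 / r) * d powr ((1 - r) ^ n)) \<longlonglongrightarrow> c powr (1 / r) * d powr 0"
    using assms d by (intro tendsto_intros LIMSEQ_power_zero) auto
  then show ?thesis using d by (simp add: S_eq[abs_def] )
qed

context weight_domination
begin

lemma dominated_sqrt:
  assumes m: "dominated m" and m': "dominated m'"
  shows "dominated (\<lambda>s. sqrt (m s * m' s))"
proof (rule dominated_limit)
  have "dominated (\<lambda>s. fst (arith_harm (m s) (m' s) n)) \<and>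
      dominated (\<lambda>s. snd (arith_harm (m s) (m' s) n))" for n
  proof (induction n)
    case (Suc n)
    then have "dominated (\<lambda>s. (1/2) * (fst (arith_harm (m s) (m' s) n) + snd (arith_harm (m s) (m' s) n)))"
      "dominated (\<lambda>s. 2 * (fst (arith_harm (m s) (m' s) n) * snd (arith_harm (m s) (m' s) n) /
          (fst (arith_harm (m s) (m' s) n) + snd (arith_harm (m s) (m' s) n))))"
      by (intro dominated_scale dominated_add dominated_parallel; simp)+
    then show ?case by (simp add: Let_def case_prod_beta)
  qed (use m m' in auto)
  then show "dominated (\<lambda>s. fst (arith_harm (m s) (m' s) n))" for n by blast
  show "(\<lambda>n. fst (arith_harm (m s) (m' s) n)) \<longlonglongrightarrow> sqrt (m s * m' s)" if "s \<in> pts" for s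
    using that m m' by (intro arith_harm_tendsto dominated_pos)
  show "0 < sqrt (m s * m' s)" if "s \<in> pts" for s
    using dominated_pos[OF m that] dominated_pos[OF m' that] by simp
qed

text \<open>The exponents for which the weighted geometric mean is dominated form a closed set containing
  \<open>0\<close> and \<open>1\<close>, and the plain geometric mean makes it stable under midpoints.\<close>

lemma dominated_geometric:
  assumes m: "dominated m" and m': "dominated m'" and r: "0 \<le> r" "r \<le> 1"
  shows "dominated (\<lambda>s. m s powr r * m' s powr (1 - r))"
proof -
  define T where "T = {r. dominated (\<lambda>s. m s powr r * m' s powr (1 - r))}"
  have pos: "0 < m s" "0 < m' s" if "s \<in> pts" for s
    using that m m' dominated_pos by auto
  have "{0..1} \<subseteq> T"
  proof (rule midpoint_closed_contains_interval)
    show "closed T"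
    proof (unfold closed_sequential_limits, intro allI impI, elim conjE)
      fix f l assume f: "\<forall>n. f n \<in> T" and l: "f \<longlonglongrightarrow> l"
      have "dominated (\<lambda>s. m s powr l * m' s powr (1 - l))"
      proof (rule dominated_limit)
        show "dominated (\<lambda>s. m s powr f n * m' s powr (1 - f n))" for n
          using f by (simp add: T_def)
        show "(\<lambda>n. m s powr f n * m' s powr (1 - f n)) \<longlonglongrightarrow> m s powr l * m' s powr (1 - l)"
          if "s \<in> pts" for s
          using pos[OF that] l by (intro tendsto_intros) auto
        show "0 < m s powr l * m' s powr (1 - l)" if "s \<in> pts" for s
          using pos[OF that] by (auto intro!: mult_pos_pos)
      qed
      then show "l \<in> T" by (simp add: T_def)
    qed
    show "0 \<in> T" unfolding T_def mem_Collect_eq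
      by (rule dominated_cong[OF m']) (use pos in \<open>fastforce simp: less_imp_neq[THEN not_sym]\<close>)
    show "1 \<in> T" unfolding T_def mem_Collect_eq
      by (rule dominated_cong[OF m]) (use pos in \<open>fastforce simp: less_imp_neq[THEN not_sym]\<close>)
    show "(a + b) / 2 \<in> T" if "a \<in> T" "b \<in> T" for a b
      unfolding T_def mem_Collect_eq
    proof (rule dominated_cong[OF dominated_sqrt])
      show "dominated (\<lambda>s. m s powr a * m' s powr (1 - a))" using that by (simp add: T_def)
      show "dominated (\<lambda>s. m s powr b * m' s powr (1 - b))" using that by (simp add: T_def)
      fix s assume "s \<in> pts"
      note p = pos[OF this]
      have "m s powr a * m' s powr (1 - a) * (m s powr b * m' s powr (1 - b))
          = m s powr (a + b) * m' s powr (2 - (a + b))"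
        using p by (simp add: powr_add powr_diff power2_eq_square)
      then show "sqrt (m s powr a * m' s powr (1 - a) * (m s powr b * m' s powr (1 - b)))
        = m s powr ((a + b) / 2) * m' s powr (1 - (a + b) / 2)"
        using p by (simp add: real_sqrt_mult powr_half_sqrt[symmetric] powr_powr diff_divide_distrib)
    qed
  qed
  with r show ?thesis by (auto simp: T_def)
qed

text \<open>The power mean \<open>S\<close> of order \<open>r\<close> of the \<open>m\<^sub>n\<close>, with
  weight \<open>w\<close> each, is the fixed point of \<open>S \<mapsto> w * (\<Sum>n. m\<^sub>n powr r * S
  powr (1 - r))\<close>, a positive combination of weighted geometric means. Hence every iterate is dominated,
  and so is the limit.\<close>

lemma dominated_power_mean_pos:
  assumes N: "finite N" "N \<noteq> {}" "\<And>n. n \<in> N \<Longrightarrow> dominated (m n)"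
    and r: "0 < r" "r < 1" and w: "0 < w"
  shows "dominated (\<lambda>s. (w * (\<Sum>n\<in>N. m n s powr r)) powr (1 / r))"
proof -
  define c where "c s = w * (\<Sum>n\<in>N. m n s powr r)" for s
  define S where "S k s = rec_nat (\<Sum>n\<in>N. m n s) (\<lambda>_ t. c s * t powr (1 - r)) k" for k s
  have S0: "S 0 s = (\<Sum>n\<in>N. m n s)" and S_Suc: "S (Suc k) s = c s * S k s powr (1 - r)" for k s
    by (simp_all add: S_def)
  have posN: "0 < (\<Sum>n\<in>N. m n s)" if "s \<in> pts" for s
    using that N dominated_pos by (intro sum_pos) auto
  have c: "0 < c s" if "s \<in> pts" for s
    unfolding c_def using that N dominated_pos w
    by (intro mult_pos_pos sum_pos) (auto simp: powr_gt_zero less_imp_neq[THEN not_sym])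
  have S: "dominated (S k)" for k
  proof (induction k)
    case 0
    show ?case using dominated_sum[OF N] by (simp add: S0[abs_def])
  next
    case (Suc k)
    have "dominated (\<lambda>s. w * (\<Sum>n\<in>N. m n s powr r * S k s powr (1 - r)))"
      using r w by (intro dominated_scale dominated_sum dominated_geometric N Suc) auto
    then show ?case
      by (simp add: S_Suc[abs_def] c_def sum_distrib_right mult.assoc)
  qed
  have "dominated (\<lambda>s. c s powr (1 / r))"
  proof (rule dominated_limit[OF S])
    fix s assume s: "s \<in> pts"
    show "(\<lambda>n. S n s) \<longlonglongrightarrow> c s powr (1 / r)"
      by (rule powr_geometric_iteration_tendsto[OF c[OF s] posN[OF s] r S0 S_Suc])
  qed (use c in \<open>simp add: less_imp_neq[THEN not_sym]\<close>)
  then show ?thesis by (simp add: c_def)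
qed

text \<open>For the order \<open>-r\<close> the fixed-point equation is the same with the arithmetic mean of
  the weighted geometric means replaced by their harmonic mean.\<close>

lemma dominated_power_mean_neg:
  assumes N: "finite N" "N \<noteq> {}" "\<And>n. n \<in> N \<Longrightarrow> dominated (m n)"
    and r: "0 < r" "r < 1" and w: "0 < w"
  shows "dominated (\<lambda>s. (w * (\<Sum>n\<in>N. m n s powr (-r))) powr (-(1 / r)))"
proof -
  define c where "c s = inverse (w * (\<Sum>n\<in>N. m n s powr (-r)))" for s
  define S where "S k s = rec_nat (\<Sum>n\<in>N. m n s) (\<lambda>_ t. c s * t powr (1 - r)) k" for k s
  have S0: "S 0 s = (\<Sum>n\<in>N. m n s)" and S_Suc: "S (Suc k) s = c s * S k s powr (1 - r)" for k s
    by (simp_all add: S_def)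
  have posN: "0 < (\<Sum>n\<in>N. m n s)" if "s \<in> pts" for s
    using that N dominated_pos by (intro sum_pos) auto
  have pos: "0 < w * (\<Sum>n\<in>N. m n s powr (-r))" if "s \<in> pts" for s
    using that N dominated_pos w
    by (intro mult_pos_pos sum_pos) (auto simp: powr_gt_zero less_imp_neq[THEN not_sym])
  then have c: "0 < c s" if "s \<in> pts" for s
    using that unfolding c_def by (metis inverse_positive_iff_positive)
  have S: "dominated (S k)" for k
  proof (induction k)
    case 0
    show ?case using dominated_sum[OF N] by (simp add: S0[abs_def])
  next
    case (Suc k)
    have "dominated (\<lambda>s. inverse w * inverse (\<Sum>n\<in>N. inverse (m n s powr r * S k s powr (1 - r))))"
      using r w by (intro dominated_scale dominated_harmonic_sum dominated_geometric N Suc) auto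
    then show ?case
      by (simp add: S_Suc[abs_def] c_def powr_minus inverse_mult_distrib mult.assoc
           flip: sum_distrib_right)
  qed
  have "dominated (\<lambda>s. c s powr (1 / r))"
  proof (rule dominated_limit[OF S])
    fix s assume s: "s \<in> pts"
    show "(\<lambda>n. S n s) \<longlonglongrightarrow> c s powr (1 / r)"
      by (rule powr_geometric_iteration_tendsto[OF c[OF s] posN[OF s] r S0 S_Suc])
  qed (use c in \<open>simp add: less_imp_neq[THEN not_sym]\<close>)
  then show ?thesis
  proof (rule dominated_cong)
    fix s assume "s \<in> pts"
    from pos[OF this] show "c s powr (1 / r) = (w * (\<Sum>n\<in>N. m n s powr (-r))) powr (-(1 / r))"
      unfolding c_def by (subst inverse_powr) (simp_all only: powr_minus less_imp_le)
  qed
qed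

end

section \<open>The Stolarsky mean\<close>

text \<open>The divided difference of \<open>x \<mapsto> x powr q\<close>; \<open>power_quotient\<close> is
  its integer-order counterpart.\<close>

definition powr_quotient :: "real \<Rightarrow> real \<Rightarrow> real \<Rightarrow> real" where
  "powr_quotient q x y = (if x = y then q * x powr (q - 1) else (x powr q - y powr q) / (x - y))"

text \<open>The homogeneous two-variable mean belonging to \<open>stolarsky\<close>. Its value at the
  eigenvalues \<open>x\<close> (for the row) and \<open>y\<close> (for the column) is the kernel of
  \<open>J_op\<close>.\<close>

definition stolarsky_mean :: "real \<Rightarrow> real \<Rightarrow> real \<Rightarrow> real" where
  "stolarsky_mean p x y = y * stolarsky p (x / y)"

lemma powr_minus_one_over_pos:
  fixes x p :: real
  assumes "0 < x" "x \<noteq> 1" "p \<noteq> 0"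
  shows "0 < p * (x - 1) / (x powr p - 1)"
proof -
  have "p * (x - 1) * (x powr p - 1) > 0"
  proof (cases "x > 1"; cases "p > 0")
    assume "x > 1" "p > 0"
    then show ?thesis using powr_less_mono2[of p 1 x] by simp
  next
    assume a: "x > 1" "\<not> p > 0"
    then have "x powr p < 1" using assms powr_less_mono[of p 0 x] by simp
    then show ?thesis using a assms by (simp add: mult_neg_neg mult_neg_pos)
  next
    assume a: "\<not> x > 1" "p > 0"
    then have "x powr p < 1" using assms powr_less_mono2[of p x 1] by simp
    then show ?thesis using a assms by (simp add: mult_neg_neg mult_pos_neg)
  next
    assume a: "\<not> x > 1" "\<not> p > 0"
    then have "x powr p > 1" using assms powr_less_mono2_neg[of p x 1] by simp
    then show ?thesis using a assms by (simp add: mult_neg_neg)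
  qed
  then show ?thesis by (simp add: zero_less_divide_iff zero_less_mult_iff)
qed

lemma stolarsky_pos: "0 < x \<Longrightarrow> 0 < stolarsky p x"
  using powr_minus_one_over_pos[of x p]
  by (auto simp: stolarsky_def zero_less_divide_iff linorder_neq_iff)

lemma stolarsky_mean_pos: "0 < x \<Longrightarrow> 0 < y \<Longrightarrow> 0 < stolarsky_mean p x y"
  by (simp add: stolarsky_mean_def stolarsky_pos)

lemma powr_quotient_pos:
  assumes "0 < x" "0 < y" "q \<noteq> 0"
  shows "0 < powr_quotient q x y / q"
proof (cases "x = y")
  case False
  have "0 < q * (x / y - 1) / ((x / y) powr q - 1)"
    using assms False by (intro powr_minus_one_over_pos) auto
  also have "q * (x / y - 1) = q * (x - y) / y" using assms by (simp add: field_simps)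
  also have "(x / y) powr q - 1 = (x powr q - y powr q) / y powr q"
    using assms by (simp add: powr_divide field_simps)
  finally show ?thesis using False assms
    by (auto simp: powr_quotient_def zero_less_divide_iff zero_less_mult_iff mult_less_0_iff)
qed (use assms in \<open>simp add: powr_quotient_def\<close>)

lemma stolarsky_mean_eq_powr:
  assumes x: "0 < x" and y: "0 < y" and p: "p \<noteq> 0" "p \<noteq> 1"
  shows "stolarsky_mean p x y = (powr_quotient p x y / p) powr (1 / (p - 1))"
proof (cases "x = y")
  case True
  then show ?thesis using assms
    by (simp add: stolarsky_mean_def stolarsky_def powr_quotient_def powr_powr)
next
  case False
  define g where "g = powr_quotient p x y / p"
  have g: "0 < g" unfolding g_def using assms by (intro powr_quotient_pos)
  have "(x / y) powr p - 1 = (x powr p - y powr p) / y powr p"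
    using assms by (simp add: powr_divide field_simps)
  moreover have "p * (x / y - 1) = p * (x - y) / y" using y by (simp add: field_simps)
  ultimately have "p * (x / y - 1) / ((x / y) powr p - 1)
      = p * (x - y) / y / ((x powr p - y powr p) / y powr p)"
    by (simp only:)
  also have "\<dots> = (y powr p / y) * inverse g"
    using False by (simp add: g_def powr_quotient_def inverse_eq_divide ac_simps)
  also have "y powr p / y = y powr (p - 1)" using y by (simp add: powr_diff)
  finally have "stolarsky p (x / y) = (y powr (p - 1) * inverse g) powr (1 / (1 - p))"
    using False p y by (simp add: stolarsky_def)
  also have "\<dots> = y powr ((p - 1) * (1 / (1 - p))) * inverse g powr (1 / (1 - p))"
    using g by (simp add: powr_mult powr_powr)
  also have "(p - 1) * (1 / (1 - p)) = -1" using p by (simp add: field_simps)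
  also have "inverse g powr (1 / (1 - p)) = g powr (- (1 / (1 - p)))"
    using g by (simp add: powr_minus inverse_powr)
  also have "- (1 / (1 - p)) = 1 / (p - 1)" using p by (simp add: field_simps)
  finally show ?thesis using y by (simp add: stolarsky_mean_def g_def powr_minus)
qed

text \<open>The two limiting cases are derivatives in the order: at \<open>p = 0\<close> of \<open>x powr
  p\<close>, and at \<open>p = 1\<close> of the logarithm of the base \<open>p * (x - 1) / (x powr p -
  1)\<close>, which vanishes there.\<close>

lemma stolarsky_tendsto:
  assumes x: "0 < x"
  shows "((\<lambda>p. stolarsky p x) \<longlongrightarrow> stolarsky p x) (at p)"
proof (cases "x = 1")
  case True
  then show ?thesis by (simp add: stolarsky_def)
next
  case x1: False
  \<comment> \<open>\<open>g\<close> is the base of the power in \<open>stolarsky\<close>, continuously extended to \<open>p = 0\<close>.\<close>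
  define g where "g p = (if p = 0 then (x - 1) / ln x else p * (x - 1) / (x powr p - 1))" for p
  have lnx: "ln x \<noteq> 0" using x x1 by simp
  have g_pos: "0 < g p" for p
    using powr_minus_one_over_pos[OF x x1, of p] x x1
    by (auto simp: g_def zero_less_divide_iff linorder_neq_iff)
  have powr_ne: "x powr p \<noteq> 1" if "p \<noteq> 0" for p
    using powr_minus_one_over_pos[OF x x1 that] by auto
  have S: "stolarsky p x = g p powr (1 / (1 - p))" if "p \<noteq> 1" for p
  proof (cases "p = 0")
    case True
    have "g 0 powr 1 = g 0" using g_pos[of 0] by (simp only: powr_one)
    then show ?thesis using True x1 by (simp add: stolarsky_def g_def)
  qed (use that x1 in \<open>simp add: stolarsky_def g_def\<close>)
  have g_lim: "(g \<longlongrightarrow> g p) (at p)" for p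
  proof (cases "p = 0")
    case True
    have "((\<lambda>p. x powr p) has_real_derivative ln x * x powr 0) (at 0)"
      using x by (auto intro!: derivative_eq_intros)
    then have "((\<lambda>p. (x powr p - 1) / p) \<longlongrightarrow> ln x) (at 0)"
      using x by (simp add: has_field_derivative_iff)
    then have "((\<lambda>p. (x - 1) / ((x powr p - 1) / p)) \<longlongrightarrow> (x - 1) / ln x) (at 0)"
      using lnx by (intro tendsto_intros)
    moreover have "\<forall>\<^sub>F p in at 0. (x - 1) / ((x powr p - 1) / p) = g p"
      by (auto simp: eventually_at_filter g_def)
    ultimately have "(g \<longlongrightarrow> (x - 1) / ln x) (at 0)"
      by (rule Lim_transform_eventually)
    then show ?thesis using True by (simp add: g_def)
  next
    case False
    have "((\<lambda>p. p * (x - 1) / (x powr p - 1)) \<longlongrightarrow> p * (x - 1) / (x powr p - 1)) (at p)"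
      using x powr_ne[OF False] by (intro tendsto_intros) auto
    moreover have "\<forall>\<^sub>F q in at p. q * (x - 1) / (x powr q - 1) = g q"
      using eventually_neq_at_within[of 0 p UNIV] by eventually_elim (auto simp: g_def)
    ultimately have "(g \<longlongrightarrow> p * (x - 1) / (x powr p - 1)) (at p)"
      by (rule Lim_transform_eventually)
    then show ?thesis using False by (simp add: g_def)
  qed
  show ?thesis
  proof (cases "p = 1")
    case False
    have "((\<lambda>p. g p powr (1 / (1 - p))) \<longlongrightarrow> g p powr (1 / (1 - p))) (at p)"
      using False g_pos[of p] by (intro tendsto_intros g_lim) auto
    moreover have "\<forall>\<^sub>F q in at p. g q powr (1 / (1 - q)) = stolarsky q x"
      using eventually_neq_at_within[of 1 p UNIV] by eventually_elim (auto simp: S)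
    ultimately show ?thesis
      by (subst S[OF False]) (rule Lim_transform_eventually)
  next
    case True
    define h where "h p = ln (p * (x - 1) / (x powr p - 1))" for p
    have h1: "h 1 = 0" using x x1 by (simp add: h_def)
    define k where "k p = p * (x - 1) / (x powr p - 1)" for p
    have k1: "k 1 = 1" using x x1 by (simp add: k_def)
    have "(k has_real_derivative ((x - 1) * (x - 1) - (x - 1) * (x * ln x)) / ((x - 1) * (x - 1))) (at 1)"
      unfolding k_def using x x1 by (auto intro!: derivative_eq_intros)
    also have "((x - 1) * (x - 1) - (x - 1) * (x * ln x)) / ((x - 1) * (x - 1)) = 1 - x * ln x / (x - 1)"
    proof -
      have "(d * d - d * l) / (d * d) = 1 - l / d" if "d \<noteq> 0" for d l :: real
        using that by (simp add: field_simps)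
      then show ?thesis using x1 by simp
    qed
    finally have k': "(k has_real_derivative 1 - x * ln x / (x - 1)) (at 1)" .
    have "((\<lambda>p. ln (k p)) has_real_derivative 1 - x * ln x / (x - 1)) (at 1)"
      by (rule derivative_eq_intros k' | simp add: k1)+
    then have "(h has_real_derivative 1 - x * ln x / (x - 1)) (at 1)"
      by (simp add: h_def[abs_def] k_def)
    then have "((\<lambda>p. h p / (p - 1)) \<longlongrightarrow> 1 - x * ln x / (x - 1)) (at 1)"
      by (simp add: has_field_derivative_iff h1)
    then have "((\<lambda>p. exp (- (h p / (p - 1)))) \<longlongrightarrow> exp (- (1 - x * ln x / (x - 1)))) (at 1)"
      by (intro tendsto_intros)
    moreover have "\<forall>\<^sub>F p in at 1. exp (- (h p / (p - 1))) = stolarsky p x"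
      using eventually_neq_at_within[of 0 1 UNIV] eventually_neq_at_within[of 1 1 UNIV]
    proof eventually_elim
      case (elim p)
      have gp: "g p = p * (x - 1) / (x powr p - 1)" using elim by (simp add: g_def)
      have "stolarsky p x = exp (1 / (1 - p) * h p)"
      proof -
        have "ln (g p) = h p" by (simp only: h_def gp)
        then show ?thesis using g_pos[of p] by (simp add: S[OF elim(2)] powr_def)
      qed
      also have "1 / (1 - p) * h p = - (h p / (p - 1))" using elim by (simp add: field_simps)
      finally show ?case by simp
    qed
    ultimately have "((\<lambda>p. stolarsky p x) \<longlongrightarrow> exp (- (1 - x * ln x / (x - 1)))) (at 1)"
      by (rule Lim_transform_eventually)
    also have "exp (- (1 - x * ln x / (x - 1))) = exp (x * ln x / (x - 1)) / exp 1"
      by (simp flip: exp_diff)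
    also have "\<dots> = stolarsky 1 x"
      using x x1 by (simp add: stolarsky_def powr_def)
    finally show ?thesis using True by simp
  qed
qed

lemma stolarsky_mean_tendsto:
  assumes "0 < x" "0 < y" "f \<longlonglongrightarrow> p"
  shows "(\<lambda>n. stolarsky_mean (f n) x y) \<longlonglongrightarrow> stolarsky_mean p x y"
proof -
  have "isCont (\<lambda>p. stolarsky p (x / y)) p"
    using stolarsky_tendsto[of "x / y"] assms by (simp add: isCont_def)
  then have "(\<lambda>n. stolarsky (f n) (x / y)) \<longlonglongrightarrow> stolarsky p (x / y)"
    using assms(3) by (rule isCont_tendsto_compose)
  then show ?thesis unfolding stolarsky_mean_def by (intro tendsto_intros)
qed

text \<open>By continuity in \<open>p\<close>, statements about all orders in \<open>[-1, 2]\<close> need to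
  be proved only for rational orders in the open interval other than the exceptional orders \<open>0\<close>
  and \<open>1\<close>.\<close>

lemma generic_rational_sequence:
  fixes p :: real
  assumes "p \<in> {-1..2}"
  obtains f where "f \<longlonglongrightarrow> p"
    "\<And>n. f n \<in> \<rat> \<and> -1 < f n \<and> f n < 2 \<and> f n \<noteq> 0 \<and> f n \<noteq> 1"
proof -
  let ?U = "{-1<..<0} \<union> {0<..<1} \<union> {1<..<2::real}"
  have "closure (?U \<inter> \<rat>) = closure ?U"
    by (rule closure_open_Int_superset) (simp_all add: open_Un Rats_closure_real)
  also have "\<dots> = {-1..2}" by (auto simp: closure_Un)
  finally have "p \<in> closure (?U \<inter> \<rat>)" using assms by simp
  then obtain f where f: "\<forall>n. f n \<in> ?U \<inter> \<rat>" "f \<longlonglongrightarrow> p"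
    unfolding closure_sequential by blast
  show ?thesis
  proof (rule that[OF f(2)])
    show "f n \<in> \<rat> \<and> -1 < f n \<and> f n < 2 \<and> f n \<noteq> 0 \<and> f n \<noteq> 1" for n
      using spec[OF f(1), of n] by auto
  qed
qed

text \<open>For \<open>-1 < p < 0\<close> the mean is a weighted geometric mean of \<open>sqrt (x * y)\<close>
  and of the mean of the opposite order. The reason is \<open>x powr (-q) - y powr (-q) = - (x powr q - y powr
  q) * (x * y) powr (-q)\<close>.\<close>

lemma stolarsky_mean_negative_order:
  assumes x: "0 < x" and y: "0 < y" and q: "0 < q" "q < 1"
  shows "stolarsky_mean (-q) x y
    = stolarsky_mean q x y powr ((1 - q) / (1 + q)) * sqrt (x * y) powr (1 - (1 - q) / (1 + q))"
proof -
  define g where "g = powr_quotient q x y / q"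
  have g: "0 < g" unfolding g_def using assms by (intro powr_quotient_pos) auto
  have e: "powr_quotient (-q) x y / (-q) = g * (x * y) powr (-q)"
  proof (cases "x = y")
    case True
    have "x powr (-q - 1) = x powr (q - 1) * (x powr (-q) * x powr (-q))"
      by (simp flip: powr_add)
    then show ?thesis using True q x by (simp add: g_def powr_quotient_def powr_mult)
  next
    case False
    have "x powr (-q) - y powr (-q) = - (x powr q - y powr q) * (x powr (-q) * y powr (-q))"
      using x y by (simp add: powr_minus field_simps)
    then have "powr_quotient (-q) x y / (-q)
        = - (x powr q - y powr q) * (x powr (-q) * y powr (-q)) / (x - y) / (-q)"
      using False by (simp only: powr_quotient_def if_False)
    also have "\<dots> = (x powr q - y powr q) / (x - y) / q * (x powr (-q) * y powr (-q))"
    proof -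
      have "- u * v / d / (-q) = u / d / q * v" for u v d :: real by simp
      then show ?thesis .
    qed
    also have "\<dots> = g * (x * y) powr (-q)"
      using False x y by (simp add: g_def powr_quotient_def powr_mult)
    finally show ?thesis .
  qed
  have s: "sqrt (x * y) powr (1 - (1 - q) / (1 + q)) = (x * y) powr (q / (1 + q))"
  proof -
    have "1 / 2 * (1 - (1 - q) / (1 + q)) = q / (1 + q)" using q by (simp add: field_simps)
    moreover have "sqrt (x * y) = (x * y) powr (1 / 2)" using x y by (simp add: powr_half_sqrt)
    ultimately show ?thesis by (simp only: powr_powr)
  qed
  have e1: "1 / (q - 1) * ((1 - q) / (1 + q)) = 1 / (-q - 1)"
    using q by (simp add: divide_simps) (simp add: algebra_simps)
  have e2: "-q * (1 / (-q - 1)) = q / (1 + q)"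
    using q by (simp add: divide_simps) (simp add: algebra_simps)
  have "stolarsky_mean (-q) x y = (g * (x * y) powr (-q)) powr (1 / (-q - 1))"
    unfolding e[symmetric] using assms by (intro stolarsky_mean_eq_powr) auto
  also have "\<dots> = g powr (1 / (-q - 1)) * (x * y) powr (-q * (1 / (-q - 1)))"
    using g x y by (simp only: powr_mult powr_powr)
  also have "g powr (1 / (-q - 1)) = stolarsky_mean q x y powr ((1 - q) / (1 + q))"
    using assms by (simp only: stolarsky_mean_eq_powr powr_powr e1 flip: g_def) 
  finally show ?thesis by (simp only: e2 s)
qed

text \<open>Divided by its order \<open>r + 1\<close>, the divided difference is the integral of \<open>(y + s
  (x - y)) powr r\<close> over \<open>s\<close> in \<open>[0, 1]\<close>. As the integrand is monotone, the
  error of the Riemann sum with \<open>N + 1\<close> terms telescopes to at most its total variation divided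
  by \<open>N + 1\<close>.\<close>

lemma riemann_sum_powr_tendsto:
  fixes x y r :: real
  assumes x: "0 < x" and y: "0 < y" and r: "r \<noteq> -1"
  shows "(\<lambda>N. 1 / real (Suc N) * (\<Sum>j<Suc N. (y + real j / real (Suc N) * (x - y)) powr r))
     \<longlonglongrightarrow> powr_quotient (r + 1) x y / (r + 1)"
proof (cases "x = y")
  case True
  have "1 / real (Suc N) * (\<Sum>j<Suc N. (y + real j / real (Suc N) * (x - y)) powr r) = y powr r" for N
  proof -
    have "1 + real N \<noteq> 0" by linarith
    then show ?thesis using True by simp
  qed
  then show ?thesis using True r by (simp add: powr_quotient_def)
next
  case False
  define F where "F s = (y + s * (x - y)) powr (r + 1) / ((r + 1) * (x - y))" for s
  define g where "g s = (y + s * (x - y)) powr r" for s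
  define L where "L = powr_quotient (r + 1) x y / (r + 1)"
  have pos: "0 < y + s * (x - y)" if "0 \<le> s" "s \<le> 1" for s
  proof -
    have "y + s * (x - y) = (1 - s) * y + s * x" by (simp add: algebra_simps)
    also have "\<dots> > 0"
      using that x y by (cases "s = 0") (auto intro!: add_nonneg_pos)
    finally show ?thesis .
  qed
  have F': "(F has_real_derivative g s) (at s)" if "0 \<le> s" "s \<le> 1" for s
  proof -
    have r1: "r + 1 \<noteq> 0" using r by linarith
    show ?thesis
      unfolding F_def g_def using pos[OF that] False r1
      by (auto intro!: derivative_eq_intros)
  qed
  have L: "L = F 1 - F 0"
    using False r by (simp add: L_def F_def powr_quotient_def diff_divide_distrib[symmetric] mult.commute)
  have mono: "\<bar>g t - g s\<bar> \<le> \<bar>g u - g s\<bar>" "(g u - g s) * (g 1 - g 0) \<ge> 0"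
    if "0 \<le> s" "s \<le> t" "t \<le> u" "u \<le> 1" for s t u
  proof -
    have incr: "g a \<le> g b" if "0 \<le> a" "a \<le> b" "b \<le> 1" "0 \<le> r * (x - y)" for a b
    proof (cases "0 \<le> r")
      case True
      show ?thesis
      proof (cases "r = 0")
        case False
        then have "x \<ge> y" using True that by (simp add: zero_le_mult_iff)
        then have "a * (x - y) \<le> b * (x - y)" using that by (intro mult_right_mono) auto
        then show ?thesis unfolding g_def
          using True pos[of a] that by (intro powr_mono2) auto
      qed (use pos[of a] pos[of b] that in \<open>auto simp: g_def\<close>)
    next
      case False
      then have "x \<le> y" using that by (auto simp: zero_le_mult_iff)
      then have "b * (x - y) \<le> a * (x - y)" using that by (intro mult_right_mono_neg) auto
      then show ?thesis unfolding g_def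
        using False pos[of b] that by (intro powr_mono2') auto
    qed
    have decr: "g b \<le> g a" if "0 \<le> a" "a \<le> b" "b \<le> 1" "\<not> 0 \<le> r * (x - y)" for a b
    proof (cases "0 \<le> r")
      case True
      then have "x \<le> y" using that by (auto simp: zero_le_mult_iff)
      then have "b * (x - y) \<le> a * (x - y)" using that by (intro mult_right_mono_neg) auto
      then show ?thesis unfolding g_def
        using True pos[of b] that by (intro powr_mono2) auto
    next
      case False
      then have "x \<ge> y" using that by (auto simp: zero_le_mult_iff)
      then have "a * (x - y) \<le> b * (x - y)" using that by (intro mult_right_mono) auto
      then show ?thesis unfolding g_def
        using False pos[of a] that by (intro powr_mono2') auto
    qed
    show "\<bar>g t - g s\<bar> \<le> \<bar>g u - g s\<bar>" "(g u - g s) * (g 1 - g 0) \<ge> 0"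
    proof -
      have "(g s \<le> g t \<and> g t \<le> g u \<and> g 0 \<le> g 1) \<or> (g t \<le> g s \<and> g u \<le> g t \<and> g 1 \<le> g 0)"
      proof (cases "0 \<le> r * (x - y)")
        case True
        then have "g s \<le> g t" "g t \<le> g u" "g 0 \<le> g 1" using that by (intro incr; simp)+
        then show ?thesis by simp
      next
        case False
        then have "g t \<le> g s" "g u \<le> g t" "g 1 \<le> g 0" using that by (intro decr; simp)+
        then show ?thesis by simp
      qed
      then show "\<bar>g t - g s\<bar> \<le> \<bar>g u - g s\<bar>" "(g u - g s) * (g 1 - g 0) \<ge> 0"
        by (auto simp: zero_le_mult_iff)
    qed
  qed
  have bound: "\<bar>1 / real (Suc N) * (\<Sum>j<Suc N. g (real j / real (Suc N))) - L\<bar>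
      \<le> \<bar>g 1 - g 0\<bar> * inverse (real (Suc N))" for N
  proof -
    define n where "n = real (Suc N)"
    have n: "0 < n" by (simp add: n_def)
    have step: "\<bar>g (real j / n) / n - (F (real (Suc j) / n) - F (real j / n))\<bar>
        \<le> sgn (g 1 - g 0) * (g (real (Suc j) / n) - g (real j / n)) / n" if "j < Suc N" for j
    proof -
      define s u where "s = real j / n" and "u = real (Suc j) / n"
      have su: "0 \<le> s" "s < u" "u \<le> 1" "u - s = 1 / n"
        using that n by (auto simp: s_def u_def divide_strict_right_mono n_def divide_simps)
      have "\<exists>z>s. z < u \<and> F u - F s = (u - s) * g z"
        using su by (intro MVT2 F') auto
      then obtain z where z: "s < z" "z < u" "F u - F s = (u - s) * g z" by blast
      \<comment> \<open>The sign of the increments of \<open>g\<close> is constant, which removes the absolute values before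
    telescoping.\<close>
    have sg: "\<bar>g u - g s\<bar> = sgn (g 1 - g 0) * (g u - g s)"
      proof (cases "g 1 = g 0")
        case True
        have "x powr r = y powr r" using True by (simp add: g_def)
        have "r = 0"
        proof (rule ccontr)
          assume "r \<noteq> 0"
          then have "x = (x powr r) powr (1 / r)" "y = (y powr r) powr (1 / r)"
            using x y by (simp_all add: powr_powr)
          with \<open>x powr r = y powr r\<close> False show "False" by simp
        qed
        then have "g u = g s" using pos[of u] pos[of s] su by (simp add: g_def)
        then show ?thesis by simp
      next
        case False
        then show ?thesis using mono(2)[of s u u] su
          by (auto simp: sgn_if zero_le_mult_iff)
      qed
      have "\<bar>g s / n - (F u - F s)\<bar> = \<bar>g z - g s\<bar> / n"
        using n unfolding z(3) su(4) by (simp add: diff_divide_distrib[symmetric] abs_minus_commute)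
      also have "\<dots> \<le> \<bar>g u - g s\<bar> / n"
        using mono(1)[of s z u] su z n by (intro divide_right_mono) auto
      finally show ?thesis unfolding sg by (simp add: s_def u_def)
    qed
    have tel: "(\<Sum>j<Suc N. f (real (Suc j) / n) - f (real j / n)) = f 1 - f 0" for f :: "real \<Rightarrow> real"
      using sum_lessThan_telescope[of "\<lambda>j. f (real j / n)" "Suc N"] n by (simp add: n_def)
    have "1 / n * (\<Sum>j<Suc N. g (real j / n)) - L
       = (\<Sum>j<Suc N. g (real j / n) / n - (F (real (Suc j) / n) - F (real j / n)))"
      unfolding sum_subtractf[of "\<lambda>j. g (real j / n) / n"] tel[of F] L
      by (simp only: sum_divide_distrib[symmetric]) simp
    also have "\<bar>\<dots>\<bar> \<le> (\<Sum>j<Suc N. sgn (g 1 - g 0) * (g (real (Suc j) / n) - g (real j / n)) / n)"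
      using step by (intro order_trans[OF sum_abs] sum_mono) auto
    also have "\<dots> = sgn (g 1 - g 0) * (g 1 - g 0) / n"
      using tel[of g] by (simp only: sum_distrib_left[symmetric] sum_divide_distrib[symmetric])
    finally show ?thesis by (simp add: n_def sgn_mult_self_eq divide_inverse mult.commute abs_sgn)
  qed
  have "(\<lambda>N. \<bar>g 1 - g 0\<bar> * inverse (real (Suc N))) \<longlonglongrightarrow> \<bar>g 1 - g 0\<bar> * 0"
    by (intro tendsto_mult tendsto_const LIMSEQ_inverse_real_of_nat)
  then have lim: "(\<lambda>N. \<bar>g 1 - g 0\<bar> * inverse (real (Suc N))) \<longlonglongrightarrow> 0"
    by (simp only: mult_zero_right)
  have "(\<lambda>N. 1 / real (Suc N) * (\<Sum>j<Suc N. g (real j / real (Suc N))) - L) \<longlonglongrightarrow> 0"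
    by (rule Lim_null_comparison[OF always_eventually lim])
       (unfold real_norm_def, rule allI, rule bound)
  then show ?thesis by (simp only: LIM_zero_iff g_def L_def)
qed

section \<open>The Stolarsky mean of dominated weights\<close>

context weight_domination
begin

text \<open>By the integral formula the Stolarsky mean of order \<open>p\<close> is the power mean of order
  \<open>p - 1\<close> of all the weighted arithmetic means of \<open>a\<close> and \<open>b\<close>; Riemann
  sums make it a limit of finite power means, whose order lies between \<open>-1\<close> and
  \<open>1\<close>.\<close>

lemma dominated_stolarsky_mean_between:
  assumes a: "dominated a" and b: "dominated b" and p: "0 < p" "p < 2" "p \<noteq> 1"
  shows "dominated (\<lambda>s. stolarsky_mean p (a s) (b s))"
proof (rule dominated_limit)
  let ?c = "\<lambda>N j s. b s + real j / real (Suc N) * (a s - b s)"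
  have c: "dominated (?c N j)" if "j < Suc N" for N j
  proof (cases "j = 0")
    case False
    have e: "?c N j = (\<lambda>s. (1 - real j / real (Suc N)) * b s + real j / real (Suc N) * a s)"
    proof -
      have "v + t * (u - v) = (1 - t) * v + t * u" for t u v :: real
        by (simp add: algebra_simps)
      then show ?thesis by (rule ext)
    qed
    show ?thesis unfolding e
      using that False by (intro dominated_add dominated_scale a b) auto
  qed (use b in simp)
  let ?M = "\<lambda>N s. (1 / real (Suc N) * (\<Sum>j<Suc N. ?c N j s powr (p - 1))) powr (1 / (p - 1))"
  show "dominated (?M N)" for N
  proof (cases "p > 1")
    case True
    then show ?thesis
      using p by (intro dominated_power_mean_pos c) auto
  next
    case False
    have "dominated (\<lambda>s. (1 / real (Suc N) * (\<Sum>j<Suc N. ?c N j s powr (- (1 - p)))) powr (-(1 / (1 - p))))"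
      using p False by (intro dominated_power_mean_neg c) auto
    moreover have "-(1 / (1 - p)) = 1 / (p - 1)" using p by (simp add: field_simps)
    ultimately show ?thesis by simp
  qed
  fix s assume s: "s \<in> pts"
  have pos: "0 < a s" "0 < b s" using s a b dominated_pos by auto
  have q: "0 < powr_quotient p (a s) (b s) / p" using pos p by (intro powr_quotient_pos) auto
  have "(\<lambda>N. ?M N s) \<longlonglongrightarrow> (powr_quotient (p - 1 + 1) (a s) (b s) / (p - 1 + 1)) powr (1 / (p - 1))"
    using pos p q by (intro tendsto_powr tendsto_const riemann_sum_powr_tendsto) auto
  then show "(\<lambda>N. ?M N s) \<longlonglongrightarrow> stolarsky_mean p (a s) (b s)"
    using pos p by (simp add: stolarsky_mean_eq_powr)
  show "0 < stolarsky_mean p (a s) (b s)" using pos by (rule stolarsky_mean_pos)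
qed

lemma dominated_stolarsky_mean:
  assumes a: "dominated a" and b: "dominated b" and p: "p \<in> {-1..2}"
  shows "dominated (\<lambda>s. stolarsky_mean p (a s) (b s))"
proof -
  have pos: "0 < a s" "0 < b s" if "s \<in> pts" for s using that a b dominated_pos by auto
  obtain f where f: "f \<longlonglongrightarrow> p" "\<And>n. f n \<in> \<rat> \<and> -1 < f n \<and> f n < 2 \<and> f n \<noteq> 0 \<and> f n \<noteq> 1"
    using generic_rational_sequence[OF p] by blast
  show ?thesis
  proof (rule dominated_limit)
    show "dominated (\<lambda>s. stolarsky_mean (f n) (a s) (b s))" for n
    proof (cases "f n > 0")
      case True
      then show ?thesis using f(2)[of n] by (intro dominated_stolarsky_mean_between a b) auto
    next
      case False
      define q where "q = - f n"
      have q: "0 < q" "q < 1" "f n = -q" using False f(2)[of n] by (auto simp: q_def)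
      have "dominated (\<lambda>s. stolarsky_mean q (a s) (b s) powr ((1 - q) / (1 + q)) *
          sqrt (a s * b s) powr (1 - (1 - q) / (1 + q)))"
        using q by (intro dominated_geometric dominated_stolarsky_mean_between dominated_sqrt a b)
          (auto simp: field_simps)
      then show ?thesis
        unfolding q(3)
        by (rule dominated_cong) (use pos q stolarsky_mean_negative_order in auto)
    qed
  qed (use pos f in \<open>auto intro!: stolarsky_mean_tendsto stolarsky_mean_pos\<close>)
qed

end

section \<open>The reciprocal of the Stolarsky mean is Schur positive\<close>

text \<open>For \<open>q = k / m\<close> the substitution \<open>x = z ^ m\<close> turns the divided
  difference into a ratio of two integer ones.\<close>

lemma schur_positive_powr_quotient_powr:
  fixes x :: "'i \<Rightarrow> real"
  assumes x: "\<And>i. i \<in> I \<Longrightarrow> 0 < x i" and s: "0 < s" and q: "q \<in> \<rat>" "0 < q" "q < 1"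
  shows "schur_positive I (\<lambda>i j. powr_quotient q (x i) (x j) powr s)"
proof -
  obtain k m :: nat where km: "m \<noteq> 0" "q = real k / real m"
    using Rats_abs_nat_div_natE[OF q(1)] q(2) by (metis abs_of_pos)
  have k: "0 < k" "k < m" using q km by (auto simp: field_simps)
  define z where "z i = x i powr (1 / real m)" for i
  have z: "0 < z i" if "i \<in> I" for i using x[OF that] by (simp add: z_def)
  have zm: "z i ^ m = x i" and zk: "z i ^ k = x i powr q" if "i \<in> I" for i
    using x[OF that] z[OF that] km by (simp_all add: z_def powr_powr flip: powr_realpow)
  have "schur_positive I (\<lambda>i j. (power_quotient k (z i) (z j) / power_quotient m (z i) (z j)) powr s)"
    using z s k by (intro schur_positive_power_quotient_powr) auto
  then show ?thesis
  proof (rule schur_positive_cong)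
    fix i j assume ij: "i \<in> I" "j \<in> I"
    have "power_quotient k (z i) (z j) / power_quotient m (z i) (z j) = powr_quotient q (x i) (x j)"
    proof (cases "x i = x j")
      case True
      then have "z i = z j" by (simp add: z_def)
      have "z j ^ (k - 1) = z j ^ k / z j" "z j ^ (m - 1) = z j ^ m / z j"
        using k z[OF ij(2)] by (simp_all add: power_diff)
      then show ?thesis
        using x[OF ij(2)] z[OF ij(2)] True \<open>z i = z j\<close> km
        by (simp add: power_quotient_diag powr_quotient_def zm[OF ij(2)] zk[OF ij(2)] powr_diff)
    next
      case False
      then have ne: "z i - z j \<noteq> 0" using zm[OF ij(1)] zm[OF ij(2)] by auto
      have "power_quotient n (z i) (z j) = (z i ^ n - z j ^ n) / (z i - z j)" for n
        using power_quotient_mult[of "z i" "z j" n] ne by (simp add: field_simps)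
      then show ?thesis using False ne ij by (simp add: powr_quotient_def zm zk)
    qed
    then show "(power_quotient k (z i) (z j) / power_quotient m (z i) (z j)) powr s
      = powr_quotient q (x i) (x j) powr s" by simp
  qed
qed

lemma inverse_powr_quotient:
  assumes "0 < x" "0 < y" "p \<noteq> 0"
  shows "inverse (powr_quotient p x y) = powr_quotient (1 / p) (x powr p) (y powr p)"
proof (cases "x = y")
  case True
  have "p * (1 / p - 1) = - (p - 1)" using assms by (simp add: field_simps)
  then have "powr_quotient (1 / p) (x powr p) (y powr p) = 1 / p * y powr (- (p - 1))"
    using True by (simp add: powr_quotient_def powr_powr)
  also have "\<dots> = 1 / p * inverse (y powr (p - 1))"
    by (simp only: powr_minus)
  finally show ?thesis using True by (simp add: powr_quotient_def inverse_eq_divide)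
next
  case False
  have cancel: "(t powr p) powr (1 / p) = t" if "0 < t" for t
    using that assms by (simp add: powr_powr)
  have "x powr p \<noteq> y powr p"
    using False cancel[OF assms(1)] cancel[OF assms(2)] by auto
  then show ?thesis using False assms cancel by (simp add: powr_quotient_def)
qed

text \<open>For a generic rational order the reciprocal of the mean is, up to positive constants and rank-one
  factors, a positive power of a divided difference with order in \<open>(0, 1)\<close>. For \<open>1 < p <
  2\<close> this order is \<open>1 / p\<close>, evaluated at \<open>x powr p\<close> and \<open>y powr
  p\<close>; for \<open>0 < p < 1\<close> it is \<open>p\<close>; for negative \<open>p\<close> it is
  \<open>-p\<close>, the rank-one factor being a power of \<open>x * y\<close>.\<close>

lemma schur_positive_inverse_stolarsky_mean:
  fixes x :: "'i \<Rightarrow> real"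
  assumes x: "\<And>i. i \<in> I \<Longrightarrow> 0 < x i" and p: "p \<in> {-1..2}"
  shows "schur_positive I (\<lambda>i j. inverse (stolarsky_mean p (x i) (x j)))"
proof -
  obtain f where f: "f \<longlonglongrightarrow> p" "\<And>n. f n \<in> \<rat> \<and> -1 < f n \<and> f n < 2 \<and> f n \<noteq> 0 \<and> f n \<noteq> 1"
    using generic_rational_sequence[OF p] by blast
  show ?thesis
  proof (rule schur_positive_limit)
    fix n
    define q where "q = f n"
    have q: "q \<in> \<rat>" "-1 < q" "q < 2" "q \<noteq> 0" "q \<noteq> 1" using f(2)[of n] by (auto simp: q_def)
    consider "1 < q" | "0 < q" "q < 1" | "q < 0" using q by linarith
    then have "schur_positive I (\<lambda>i j. inverse (stolarsky_mean q (x i) (x j)))"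
    proof cases
      case 1
      have "schur_positive I (\<lambda>i j. q powr (1 / (q - 1)) *
          powr_quotient (1 / q) (x i powr q) (x j powr q) powr (1 / (q - 1)))"
        using 1 q x by (intro schur_positive_mult schur_positive_const schur_positive_powr_quotient_powr)
          (auto simp: less_imp_neq[THEN not_sym])
      then show ?thesis
      proof (rule schur_positive_cong)
        fix i j assume ij: "i \<in> I" "j \<in> I"
        note pos = x[OF ij(1)] x[OF ij(2)]
        define g where "g = powr_quotient q (x i) (x j)"
        have g: "0 < g" using powr_quotient_pos[OF pos q(4)] 1 by (simp add: g_def zero_less_divide_iff)
        have "inverse (stolarsky_mean q (x i) (x j)) = (inverse (g / q)) powr (1 / (q - 1))"
        proof -
          have "stolarsky_mean q (x i) (x j) = (g / q) powr (1 / (q - 1))"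
            using pos q by (simp add: stolarsky_mean_eq_powr flip: g_def)
          then show ?thesis using 1 g by (simp only: inverse_powr)
        qed
        also have "inverse (g / q) = q * inverse g" using 1 g by (simp add: field_simps)
        finally show "q powr (1 / (q - 1)) *
          powr_quotient (1 / q) (x i powr q) (x j powr q) powr (1 / (q - 1))
          = inverse (stolarsky_mean q (x i) (x j))"
          using pos 1 g by (simp add: powr_mult g_def flip: inverse_powr_quotient)
      qed
    next
      case 2
      have "schur_positive I (\<lambda>i j. (1 / q) powr (1 / (1 - q)) *
          powr_quotient q (x i) (x j) powr (1 / (1 - q)))"
        using 2 q x by (intro schur_positive_mult schur_positive_const schur_positive_powr_quotient_powr) auto
      then show ?thesis
      proof (rule schur_positive_cong)
        fix i j assume ij: "i \<in> I" "j \<in> I"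
        note pos = x[OF ij(1)] x[OF ij(2)]
        define g where "g = powr_quotient q (x i) (x j)"
        have g: "0 < g" using powr_quotient_pos[OF pos q(4)] 2 by (simp add: g_def zero_less_divide_iff)
        have "inverse (stolarsky_mean q (x i) (x j)) = (g / q) powr (- (1 / (q - 1)))"
          using pos q by (simp add: stolarsky_mean_eq_powr powr_minus flip: g_def)
        also have "- (1 / (q - 1)) = 1 / (1 - q)" using q by (simp add: field_simps)
        also have "g / q = (1 / q) * g" by simp
        finally show "(1 / q) powr (1 / (1 - q)) * powr_quotient q (x i) (x j) powr (1 / (1 - q))
          = inverse (stolarsky_mean q (x i) (x j))"
          using 2 g by (simp only: powr_mult g_def)
      qed
    next
      case 3
      define r where "r = -q"
      have r: "0 < r" "r < 1" "q = -r" "r \<in> \<rat>" using 3 q by (auto simp: r_def)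
      let ?h = "\<lambda>i. x i powr (- r / (1 + r))"
      have "schur_positive I (\<lambda>i j. ((1 / r) powr (1 / (1 + r)) * (?h i * ?h j)) *
          powr_quotient r (x i) (x j) powr (1 / (1 + r)))"
        using r x by (intro schur_positive_mult[of I "\<lambda>i j. _ * (?h i * ?h j)"] schur_positive_mult[of I "\<lambda>i j. _"]
            schur_positive_const schur_positive_rank_one schur_positive_powr_quotient_powr) auto
      then show ?thesis
      proof (rule schur_positive_cong)
        fix i j assume ij: "i \<in> I" "j \<in> I"
        note pos = x[OF ij(1)] x[OF ij(2)]
        define g where "g = powr_quotient r (x i) (x j)"
        have g: "0 < g" using powr_quotient_pos[OF pos, of r] r by (simp add: g_def zero_less_divide_iff)
        have e1: "1 / (r - 1) * ((1 - r) / (1 + r)) = - (1 / (1 + r))"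
          using r by (simp add: divide_simps)
        have e2: "1 / 2 * (1 - (1 - r) / (1 + r)) = - (- r / (1 + r))" using r by (simp add: field_simps)
        have s: "sqrt (x i * x j) = (x i * x j) powr (1 / 2)" using pos by (simp add: powr_half_sqrt)
        have "stolarsky_mean q (x i) (x j)
           = ((1 / r) * g) powr (- (1 / (1 + r))) * (x i * x j) powr (- (- r / (1 + r)))"
        proof -
          have m: "stolarsky_mean r (x i) (x j) = (g / r) powr (1 / (r - 1))"
            using pos r by (simp add: stolarsky_mean_eq_powr g_def)
          show ?thesis
            unfolding r(3) stolarsky_mean_negative_order[OF pos r(1,2)] s m powr_powr e1 e2 by simp
        qed
        then have "inverse (stolarsky_mean q (x i) (x j))
            = ((1 / r) * g) powr (1 / (1 + r)) * (x i * x j) powr (- r / (1 + r))"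
          by (simp only: powr_minus inverse_mult_distrib inverse_inverse_eq)
        then show "((1 / r) powr (1 / (1 + r)) * (?h i * ?h j)) *
          powr_quotient r (x i) (x j) powr (1 / (1 + r)) = inverse (stolarsky_mean q (x i) (x j))"
          using pos by (simp only: powr_mult g_def mult_ac)
      qed
    qed
    then show "schur_positive I (\<lambda>i j. inverse (stolarsky_mean (f n) (x i) (x j)))"
      by (simp only: q_def)
  next
    fix i j assume ij: "i \<in> I" "j \<in> I"
    show "(\<lambda>n. inverse (stolarsky_mean (f n) (x i) (x j))) \<longlonglongrightarrow> inverse (stolarsky_mean p (x i) (x j))"
      using x[OF ij(1)] x[OF ij(2)] stolarsky_mean_pos[of "x i" "x j" p]
      by (intro tendsto_inverse stolarsky_mean_tendsto f) auto
  qed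
qed

section \<open>The Hilbert--Schmidt adjoint\<close>

lemma hs_inner_entries: "hs_inner X Y = (\<Sum>i\<in>UNIV. \<Sum>j\<in>UNIV. cnj (X $ j $ i) * Y $ j $ i)"
  by (simp add: hs_inner_def trace_def matrix_matrix_mult_def conj_transpose_def)

lemma hs_inner_add_right: "hs_inner X (Y + Z) = hs_inner X Y + hs_inner X Z"
  by (simp add: hs_inner_entries distrib_left sum.distrib)

lemma hs_inner_diff_right: "hs_inner X (Y - Z) = hs_inner X Y - hs_inner X Z"
  by (simp add: hs_inner_entries right_diff_distrib sum_subtractf)

lemma hs_inner_mscale_right: "hs_inner X (mscale c Y) = c * hs_inner X Y"
  by (simp add: hs_inner_entries mscale_def sum_distrib_left mult_ac)

lemma cnj_hs_inner: "cnj (hs_inner X Y) = hs_inner Y X"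
  by (simp add: hs_inner_entries mult.commute)

lemma Re_hs_inner_commute: "Re (hs_inner X Y) = Re (hs_inner Y X)"
proof -
  have "Re (hs_inner Y X) = Re (cnj (hs_inner X Y))" by (simp only: cnj_hs_inner)
  then show ?thesis by simp
qed

lemma hs_inner_add_left: "hs_inner (X + Y) Z = hs_inner X Z + hs_inner Y Z"
  by (simp add: hs_inner_entries distrib_right sum.distrib)

lemma hs_inner_mscale_left: "hs_inner (mscale c X) Y = cnj c * hs_inner X Y"
  by (simp add: hs_inner_entries mscale_def sum_distrib_left mult_ac)

lemma hs_inner_zero_left [simp]: "hs_inner 0 Y = 0"
  by (simp add: hs_inner_entries)

lemma hs_inner_sum_left: "hs_inner (sum f A) Y = (\<Sum>a\<in>A. hs_inner (f a) Y)"
  by (induction A rule: infinite_finite_induct) (simp_all add: hs_inner_add_left)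

lemma hs_inner_self_eq_zero:
  assumes "hs_inner X X = 0"
  shows "X = 0"
proof -
  have "hs_inner X X = of_real (\<Sum>i\<in>UNIV. \<Sum>j\<in>UNIV. (cmod (X $ j $ i))\<^sup>2)"
    by (simp add: hs_inner_entries complex_norm_square mult.commute del: of_real_power)
  then have "(\<Sum>i\<in>UNIV. \<Sum>j\<in>UNIV. (cmod (X $ j $ i))\<^sup>2) = 0"
    using assms by (metis of_real_eq_0_iff)
  then have "\<forall>i j. X $ j $ i = 0"
    by (simp add: sum_nonneg_eq_0_iff sum_nonneg)
  then show ?thesis by (simp add: vec_eq_iff)
qed

lemma hs_inner_eqI:
  assumes "\<And>X. hs_inner X Y = hs_inner X Z"
  shows "Y = Z"
  using hs_inner_self_eq_zero[of "Y - Z"] assms[of "Y - Z"] by (simp add: hs_inner_diff_right)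

text \<open>The matrix entries of the adjoint in an orthonormal basis are forced to be the inner products with
  the images of the matrix units; the zero matrix is used only to obtain some orthonormal basis.\<close>

lemma hs_adjoint:
  fixes \<alpha> :: "complex^'n^'n \<Rightarrow> complex^'m^'m"
  assumes lin: "Vector_Spaces.linear mscale mscale \<alpha>"
  shows "hs_inner (\<alpha> X) Y = hs_inner X (hs_adjoint \<alpha> Y)"
proof -
  interpret Vector_Spaces.linear mscale mscale \<alpha> by (rule lin)
  obtain U l where U: "eigenbasis (0 :: complex^'n^'n) U l"
    by (rule hermitian_eigenbasis[of "0 :: complex^'n^'n"]) (simp add: conj_transpose_def vec_eq_iff)
  define \<beta> where "\<beta> Y = from_coeff U (\<lambda>(u, v). hs_inner (\<alpha> (outer u v)) Y)" for Y
  have \<beta>: "hs_inner (\<alpha> X) Y = hs_inner X (\<beta> Y)" for X Y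
  proof -
    have "\<alpha> X = (\<Sum>(u, v)\<in>U \<times> U. mscale (mat_coeff X u v) (\<alpha> (outer u v)))"
      by (subst from_coeff_mat_coeff[OF U, of X, symmetric])
         (simp add: from_coeff_def sum scale case_prod_unfold)
    then have "hs_inner (\<alpha> X) Y
        = (\<Sum>(u, v)\<in>U \<times> U. cnj (mat_coeff X u v) * hs_inner (\<alpha> (outer u v)) Y)"
      by (simp add: hs_inner_sum_left hs_inner_mscale_left case_prod_unfold)
    also have "\<dots> = hs_inner X (\<beta> Y)"
      unfolding hs_inner_mat_coeff[OF U] sum.cartesian_product
      by (intro sum.cong refl) (auto simp: \<beta>_def mat_coeff_from_coeff[OF U])
    finally show ?thesis .
  qed
  have "hs_adjoint \<alpha> = \<beta>"
    unfolding hs_adjoint_def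
  proof (rule the_equality)
    show "\<forall>X Y. hs_inner (\<alpha> X) Y = hs_inner X (\<beta> Y)" using \<beta> by blast
    fix \<gamma> assume "\<forall>X Y. hs_inner (\<alpha> X) Y = hs_inner X (\<gamma> Y)"
    then show "\<gamma> = \<beta>" using \<beta> by (intro ext hs_inner_eqI) metis
  qed
  then show ?thesis using \<beta> by simp
qed

lemma hs_adjoint_linear:
  fixes \<alpha> :: "complex^'n^'n \<Rightarrow> complex^'m^'m"
  assumes lin: "Vector_Spaces.linear mscale mscale \<alpha>"
  shows "hs_adjoint \<alpha> (X + Y) = hs_adjoint \<alpha> X + hs_adjoint \<alpha> Y"
    and "hs_adjoint \<alpha> (mscale c X) = mscale c (hs_adjoint \<alpha> X)"
  by (rule hs_inner_eqI;
      simp add: hs_inner_add_right hs_inner_mscale_right flip: hs_adjoint[OF lin])+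

section \<open>The Schwarz inequality for the adjoint of a channel\<close>

text \<open>The quadratic form at \<open>x\<close> is that of \<open>D\<close> at \<open>\<Sum>j<k. W j *v x
  j\<close>.\<close>

lemma block_psd_congruence:
  fixes W :: "nat \<Rightarrow> complex^'n^'n"
  assumes D: "pos_def D"
  shows "block_psd k (\<lambda>i j. conj_transpose (W i) ** D ** W j)"
  unfolding block_psd_def
proof
  fix x :: "nat \<Rightarrow> complex^'n"
  define s where "s = (\<Sum>j<k. W j *v x j)"
  have "(\<Sum>i<k. \<Sum>j<k. cinner (x i) ((conj_transpose (W i) ** D ** W j) *v x j))
      = (\<Sum>i<k. \<Sum>j<k. cinner (W i *v x i) (D *v (W j *v x j)))"
    by (simp add: matrix_vector_mul_assoc[symmetric] cinner_adjoint[of _ "conj_transpose (W _)"])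
  also have "\<dots> = cinner s (D *v s)"
    by (simp add: s_def cinner_sum_left cinner_sum_right matrix_vector_sum) (rule sum.swap)
  also have "\<dots> = of_real (Re (cinner s (D *v s)))"
  proof -
    have "cnj (cinner s (D *v s)) = cinner s (D *v s)"
      using D by (simp add: cnj_cinner cinner_adjoint[of s D] pos_def_def)
    then show ?thesis by (metis Reals_cnj_iff of_real_Re)
  qed
  also have "\<dots> \<in> \<real>\<^sub>\<ge>\<^sub>0"
    using D by (cases "s = 0") (auto simp: pos_def_def less_imp_le)
  finally show "(\<Sum>i<k. \<Sum>j<k. cinner (x i) ((conj_transpose (W i) ** D ** W j) *v x j)) \<in> \<real>\<^sub>\<ge>\<^sub>0" .
qed

lemma sum_in_nonneg_Reals: "(\<And>a. a \<in> A \<Longrightarrow> f a \<in> \<real>\<^sub>\<ge>\<^sub>0) \<Longrightarrow> sum f A \<in> \<real>\<^sub>\<ge>\<^sub>0"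
  by (induction A rule: infinite_finite_induct) (simp_all add: nonneg_Reals_add_I)

text \<open>Sum the quadratic form at \<open>x i = T i *v u\<close> over the vectors \<open>u\<close> of an
  orthonormal basis.\<close>

lemma block_psd_trace:
  fixes A :: "nat \<Rightarrow> nat \<Rightarrow> complex^'n^'n" and T :: "nat \<Rightarrow> complex^'n^'n"
  assumes A: "block_psd k A"
  shows "(\<Sum>i<k. \<Sum>j<k. trace (conj_transpose (T i) ** A i j ** T j)) \<in> \<real>\<^sub>\<ge>\<^sub>0"
proof -
  obtain U l where U: "eigenbasis (0 :: complex^'n^'n) U l"
    by (rule hermitian_eigenbasis[of "0 :: complex^'n^'n"]) (simp add: conj_transpose_def vec_eq_iff)
  have "(\<Sum>i<k. \<Sum>j<k. trace (conj_transpose (T i) ** A i j ** T j))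
      = (\<Sum>i<k. \<Sum>j<k. \<Sum>u\<in>U. cinner (T i *v u) (A i j *v (T j *v u)))"
    by (simp add: eigenbasis_trace[OF U] matrix_vector_mul_assoc[symmetric]
        cinner_adjoint[of _ "conj_transpose (T _)"])
  also have "\<dots> = (\<Sum>u\<in>U. \<Sum>i<k. \<Sum>j<k. cinner (T i *v u) (A i j *v (T j *v u)))"
    by (subst (2) sum.swap, subst sum.swap) (intro sum.cong refl sum.swap)
  also have "\<dots> \<in> \<real>\<^sub>\<ge>\<^sub>0"
    using A unfolding block_psd_def by (intro sum_in_nonneg_Reals[of U]) auto
  finally show ?thesis .
qed

lemma conj_transpose_mscale: "conj_transpose (mscale c A) = mscale (cnj c) (conj_transpose A)"
  by (simp add: conj_transpose_def mscale_def vec_eq_iff)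

lemma mscale_mult: "mscale c A ** B = mscale c (A ** B)" "A ** mscale c B = mscale c (A ** B)"
  by (simp_all add: mscale_def matrix_matrix_mult_def vec_eq_iff sum_distrib_left mult_ac)

lemma trace_mscale: "trace (mscale c A) = c * trace A"
  by (simp add: trace_def mscale_def sum_distrib_left)

lemma conj_transpose_one [simp]: "conj_transpose (mat 1) = mat 1"
  by (simp add: conj_transpose_def mat_def vec_eq_iff)

text \<open>Evaluate the trace form at \<open>T 0 = c Y\<close> and \<open>T 1 = 1\<close>. Positivity for
  \<open>c = -1\<close> gives the inequality, and reality for \<open>c = \<i>\<close> and \<open>c =
  -\<i>\<close> shows that the two off-diagonal traces have the same real part.\<close>

lemma two_positive_trace_bound:
  assumes A: "block_psd 2 A"
  shows "2 * Re (trace (conj_transpose Y ** A 0 1))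
           \<le> Re (trace (conj_transpose Y ** A 0 0 ** Y)) + Re (trace (A 1 1))"
    and "Re (trace (A 1 0 ** Y)) = Re (trace (conj_transpose Y ** A 0 1))"
proof -
  define a b d e where "a = trace (conj_transpose Y ** A 0 0 ** Y)"
    and "b = trace (conj_transpose Y ** A 0 1)"
    and "d = trace (A 1 0 ** Y)" and "e = trace (A 1 1)"
  have *: "cnj c * c * a + cnj c * b + (c * d + e) \<in> \<real>\<^sub>\<ge>\<^sub>0" for c
  proof -
    have "(\<Sum>i<2. \<Sum>j<2. trace (conj_transpose (if i = 0 then mscale c Y else mat 1) ** A i j **
        (if j = (0::nat) then mscale c Y else mat 1))) \<in> \<real>\<^sub>\<ge>\<^sub>0"
      using block_psd_trace[OF A] .
    then show ?thesis
      by (simp add: numeral_2_eq_2 conj_transpose_mscale mscale_mult trace_mscale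
          a_def b_def d_def e_def mult_ac)
  qed
  have 1: "0 \<le> Re (a - b - d + e)"
    using *[of "-1"] by (simp add: complex_nonneg_Reals_iff)
  have "Im (a - \<i> * b + \<i> * d + e) = 0" "Im (a + \<i> * b - \<i> * d + e) = 0"
    using *[of "\<i>"] *[of "-\<i>"] by (simp_all add: complex_nonneg_Reals_iff)
  then have 2: "Re d = Re b" by simp
  show "2 * Re b \<le> Re a + Re e" using 1 2 by simp
  show "Re d = Re b" by (rule 2)
qed

text \<open>For left multiplication, apply \<open>\<alpha>\<close> to the positive block matrix with entries
  \<open>D\<close>, \<open>D Z\<close>, \<open>Z\<^sup>* D\<close>, \<open>Z\<^sup>* D Z\<close>, where
  \<open>Z\<close> is the adjoint map applied to \<open>Y\<close>. The off-diagonal trace is then the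
  left-hand side, and by trace preservation so is the trace of the last block; the bound \<open>2 q \<le>
  \<dots> + q\<close> remains. Replacing \<open>Z\<close> and \<open>Y\<close> by their conjugate transposes
  gives right multiplication.\<close>

lemma adjoint_schwarz:
  fixes \<alpha> :: "complex^'n^'n \<Rightarrow> complex^'m^'m"
  assumes cp: "completely_positive \<alpha>" and tp: "trace_preserving \<alpha>" and D: "pos_def D"
  shows "Re (hs_inner (hs_adjoint \<alpha> Y) (D ** hs_adjoint \<alpha> Y)) \<le> Re (hs_inner Y (\<alpha> D ** Y))"
    and "Re (hs_inner (hs_adjoint \<alpha> Y) (hs_adjoint \<alpha> Y ** D)) \<le> Re (hs_inner Y (Y ** \<alpha> D))"
proof -
  have lin: "Vector_Spaces.linear mscale mscale \<alpha>" using cp by (simp add: completely_positive_def)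
  define Z where "Z = hs_adjoint \<alpha> Y"
  have psd: "block_psd 2 (\<lambda>i j. \<alpha> (conj_transpose (if i = 0 then mat 1 else Z) ** D **
      (if j = 0 then mat 1 else Z)))" for Z
    using cp block_psd_congruence[OF D, of 2 "\<lambda>i. if i = 0 then mat 1 else Z"]
    unfolding completely_positive_def by blast
  have tr: "trace (\<alpha> X) = trace X" for X using tp by (simp add: trace_preserving_def)
  have adj: "Re (hs_inner Y (\<alpha> X)) = Re (hs_inner Z X)" for X
    by (subst (1 2) Re_hs_inner_commute) (simp add: hs_adjoint[OF lin] Z_def)
  have "2 * Re (trace (conj_transpose Y ** \<alpha> (D ** Z)))
      \<le> Re (trace (conj_transpose Y ** \<alpha> D ** Y)) + Re (trace (conj_transpose Z ** D ** Z))"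
    using two_positive_trace_bound(1)[OF psd[of Z], of Y] by (simp add: tr)
  then show "Re (hs_inner (hs_adjoint \<alpha> Y) (D ** hs_adjoint \<alpha> Y)) \<le> Re (hs_inner Y (\<alpha> D ** Y))"
    using adj[of "D ** Z"] by (simp add: hs_inner_def matrix_mul_assoc Z_def)
  have "2 * Re (trace (\<alpha> (Z ** D) ** conj_transpose Y))
      \<le> Re (trace (Y ** \<alpha> D ** conj_transpose Y)) + Re (trace (Z ** D ** conj_transpose Z))"
    using two_positive_trace_bound[OF psd[of "conj_transpose Z"], of "conj_transpose Y"] by (simp add: tr)
  moreover have "trace (\<alpha> (Z ** D) ** conj_transpose Y) = hs_inner Y (\<alpha> (Z ** D))"
    "trace (Y ** \<alpha> D ** conj_transpose Y) = hs_inner Y (Y ** \<alpha> D)"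
    "trace (Z ** D ** conj_transpose Z) = hs_inner Z (Z ** D)"
    unfolding hs_inner_def by (rule trace_mul_sym)+
  ultimately show "Re (hs_inner (hs_adjoint \<alpha> Y) (hs_adjoint \<alpha> Y ** D)) \<le> Re (hs_inner Y (Y ** \<alpha> D))"
    using adj[of "Z ** D"] by (simp add: Z_def)
qed

section \<open>Complete positivity of multipliers\<close>

text \<open>In the basis \<open>U\<close> a block matrix of size \<open>k\<close> is an array indexed by pairs
  of a block index and a basis vector, and applying the multiplier to all blocks multiplies this array by a
  kernel that ignores the block index.\<close>

lemma multiplier_completely_positive:
  assumes U: "eigenbasis D U l"
    and K: "\<And>k :: nat. schur_positive ({..<k} \<times> U) (\<lambda>i j. K (snd i) (snd j))"
  shows "completely_positive (multiplier U K)"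
  unfolding completely_positive_def
proof (intro conjI allI impI)
  show "Vector_Spaces.linear mscale mscale (multiplier U K)" by (rule multiplier_linear[OF U])
  fix k and A :: "nat \<Rightarrow> nat \<Rightarrow> complex^'a^'a"
  assume A: "block_psd k A"
  have form: "(\<Sum>i<k. \<Sum>j<k. cinner (x i) (B i j *v x j))
     = (\<Sum>w\<in>{..<k} \<times> U. \<Sum>z\<in>{..<k} \<times> U. cnj (cinner (snd w) (x (fst w))) *
          mat_coeff (B (fst w) (fst z)) (snd w) (snd z) * cinner (snd z) (x (fst z)))"
    for x and B :: "nat \<Rightarrow> nat \<Rightarrow> complex^'a^'a"
  proof -
    have c: "cinner a (C *v b) = (\<Sum>u\<in>U. \<Sum>v\<in>U. cnj (cinner u a) * mat_coeff C u v * cinner v b)"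
      for a b :: "complex^'a" and C
    proof -
      have "cinner a (C *v b) = (\<Sum>u\<in>U. cinner a u * cinner u (C *v b))" by (rule cinner_parseval[OF U])
      also have "\<dots> = (\<Sum>u\<in>U. cinner a u * cinner u (C *v (\<Sum>v\<in>U. cinner v b *s v)))"
        by (simp only: eigenbasis_expand[OF U])
      also have "\<dots> = (\<Sum>u\<in>U. \<Sum>v\<in>U. cnj (cinner u a) * mat_coeff C u v * cinner v b)"
        by (simp add: matrix_vector_sum matrix_vector_scale cinner_sum_right cinner_scale_right
            cnj_cinner mat_coeff_def sum_distrib_left mult_ac)
      finally show ?thesis .
    qed
    have "(\<Sum>i<k. \<Sum>j<k. cinner (x i) (B i j *v x j))
       = (\<Sum>i<k. \<Sum>u\<in>U. \<Sum>j<k. \<Sum>v\<in>U. cnj (cinner u (x i)) * mat_coeff (B i j) u v * cinner v (x j))"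
      unfolding c by (intro sum.cong refl sum.swap)
    then show ?thesis by (simp add: sum.cartesian_product')
  qed
  have "psd_array ({..<k} \<times> U) (\<lambda>w z. mat_coeff (A (fst w) (fst z)) (snd w) (snd z))"
    unfolding psd_array_def
  proof
    fix c :: "nat \<times> (complex^'a) \<Rightarrow> complex"
    define x where "x i = (\<Sum>u\<in>U. c (i, u) *s u)" for i
    have x: "cinner u (x i) = c (i, u)" if "u \<in> U" for u i
    proof -
      have "cinner u (x i) = (\<Sum>v\<in>U. if v = u then c (i, v) else 0)"
        unfolding x_def cinner_sum_right cinner_scale_right
        using that by (intro sum.cong refl) (auto simp: eigenbasis_cinner[OF U])
      then show ?thesis using that eigenbasis_finite[OF U] by simp
    qed
    have "(\<Sum>w\<in>{..<k} \<times> U. \<Sum>z\<in>{..<k} \<times> U. cnj (c w) *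
        mat_coeff (A (fst w) (fst z)) (snd w) (snd z) * c z)
      = (\<Sum>i<k. \<Sum>j<k. cinner (x i) (A i j *v x j))"
      unfolding form by (intro sum.cong refl) (auto simp: x)
    then show "(\<Sum>w\<in>{..<k} \<times> U. \<Sum>z\<in>{..<k} \<times> U. cnj (c w) *
        mat_coeff (A (fst w) (fst z)) (snd w) (snd z) * c z) \<in> \<real>\<^sub>\<ge>\<^sub>0"
      using A by (simp add: block_psd_def)
  qed
  then have psd: "psd_array ({..<k} \<times> U) (\<lambda>w z. complex_of_real (K (snd w) (snd z)) *
      mat_coeff (A (fst w) (fst z)) (snd w) (snd z))"
    using K[of k] by (simp add: schur_positive_def)
  show "block_psd k (\<lambda>i j. multiplier U K (A i j))"
    unfolding block_psd_def
  proof
    fix x :: "nat \<Rightarrow> complex^'a"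
    have "(\<Sum>i<k. \<Sum>j<k. cinner (x i) (multiplier U K (A i j) *v x j))
      = (\<Sum>w\<in>{..<k} \<times> U. \<Sum>z\<in>{..<k} \<times> U. cnj (cinner (snd w) (x (fst w))) *
          (complex_of_real (K (snd w) (snd z)) * mat_coeff (A (fst w) (fst z)) (snd w) (snd z)) *
          cinner (snd z) (x (fst z)))"
      unfolding form by (intro sum.cong refl) (auto simp: mat_coeff_multiplier[OF U])
    then show "(\<Sum>i<k. \<Sum>j<k. cinner (x i) (multiplier U K (A i j) *v x j)) \<in> \<real>\<^sub>\<ge>\<^sub>0"
      using psd[unfolded psd_array_def, rule_format, of "\<lambda>w. cinner (snd w) (x (fst w))"] by simp
  qed
qed

section \<open>The inverse of the Stolarsky operator\<close>

lemma inv_J_op_stolarsky: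
  assumes D: "pos_def D" and U: "eigenbasis D U l"
  shows "inv (J_op (stolarsky p) D) = multiplier U (\<lambda>u v. inverse (stolarsky_mean p (l u) (l v)))"
proof -
  have "J_op (stolarsky p) D = multiplier U (\<lambda>u v. stolarsky_mean p (l u) (l v))"
    by (simp add: J_op_multiplier[OF D U] stolarsky_mean_def)
  moreover have "stolarsky_mean p (l u) (l v) \<noteq> 0" if "u \<in> U" "v \<in> U" for u v
    using stolarsky_mean_pos[of "l u" "l v" p] eigenbasis_pos[OF D U] that by simp
  ultimately show ?thesis by (simp add: multiplier_inverse[OF U])
qed

lemma inv_J_op_stolarsky_completely_positive:
  assumes "pos_def D" and p: "p \<in> {-1..2}"
  shows "completely_positive (inv (J_op (stolarsky p) D))"
proof -
  obtain U l where U: "eigenbasis D U l"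
    using hermitian_eigenbasis[of D] assms by (auto simp: pos_def_def)
  show ?thesis
    unfolding inv_J_op_stolarsky[OF assms(1) U]
    by (intro multiplier_completely_positive[OF U] schur_positive_inverse_stolarsky_mean p)
       (use eigenbasis_pos[OF assms(1) U] in auto)
qed

lemma Re_cnj_mult_le_weighted:
  fixes x z :: complex
  assumes "0 < k"
  shows "2 * Re (cnj x * z) \<le> inverse k * (cmod x)\<^sup>2 + k * (cmod z)\<^sup>2"
proof -
  have "Re (cnj x * z) \<le> cmod x * cmod z"
    using complex_Re_le_cmod[of "cnj x * z"] by (simp add: norm_mult)
  moreover have "0 \<le> (cmod x - k * cmod z)\<^sup>2 / k" using assms by simp
  then have "2 * (cmod x * cmod z) \<le> inverse k * (cmod x)\<^sup>2 + k * (cmod z)\<^sup>2"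
    using assms by (simp add: power2_eq_square field_simps)
  ultimately show ?thesis by linarith
qed

text \<open>Write \<open>M\<close> and \<open>N\<close> for the inverse operators of \<open>D\<close> and
  \<open>\<alpha> D\<close>, and \<open>\<beta>\<close> for the adjoint of \<open>\<alpha>\<close>. Domination
  of the mean says \<open>\<langle>\<beta> Y, M\<^sup>-\<^sup>1 \<beta> Y\<rangle> \<le> \<langle>Y,
  N\<^sup>-\<^sup>1 Y\<rangle>\<close>. For \<open>Y = N (\<alpha> X)\<close> the right-hand side is \<open>q
  = \<langle>\<alpha> X, N (\<alpha> X)\<rangle> = \<langle>X, \<beta> Y\<rangle>\<close>, and \<open>2 q
  \<le> \<langle>X, M X\<rangle> + \<langle>\<beta> Y, M\<^sup>-\<^sup>1 \<beta> Y\<rangle> \<le> \<langle>X,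
  M X\<rangle> + q\<close>.\<close>

lemma inv_J_op_stolarsky_monotone:
  fixes D :: "complex^'n^'n" and \<alpha> :: "complex^'n^'n \<Rightarrow> complex^'m^'m"
  assumes D: "pos_def D" and cp: "completely_positive \<alpha>" and tp: "trace_preserving \<alpha>"
    and D': "pos_def (\<alpha> D)" and p: "p \<in> {-1..2}"
  shows "op_le (hs_adjoint \<alpha> \<circ> inv (J_op (stolarsky p) (\<alpha> D)) \<circ> \<alpha>) (inv (J_op (stolarsky p) D))"
proof -
  have lin: "Vector_Spaces.linear mscale mscale \<alpha>" using cp by (simp add: completely_positive_def)
  interpret \<alpha>: Vector_Spaces.linear mscale mscale \<alpha> by (rule lin)
  obtain U l where U: "eigenbasis D U l"
    using hermitian_eigenbasis[of D] D by (auto simp: pos_def_def)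
  obtain V l' where V: "eigenbasis (\<alpha> D) V l'"
    using hermitian_eigenbasis[of "\<alpha> D"] D' by (auto simp: pos_def_def)
  note pos = eigenbasis_pos[OF D U] and pos' = eigenbasis_pos[OF D' V]
  define m where "m s = stolarsky_mean p (fst s) (snd s)" for s :: "real \<times> real"
  define M where "M = multiplier U (\<lambda>u v. inverse (m (l u, l v)))"
  define N where "N = multiplier V (\<lambda>u v. inverse (m (l' u, l' v)))"
  have M: "inv (J_op (stolarsky p) D) = M" and N: "inv (J_op (stolarsky p) (\<alpha> D)) = N"
    by (simp_all add: M_def N_def m_def inv_J_op_stolarsky[OF D U] inv_J_op_stolarsky[OF D' V])
  let ?\<beta> = "hs_adjoint \<alpha>"
  interpret weight_domination "U \<times> U" "\<lambda>(u, v). (l u, l v)" "V \<times> V" "\<lambda>(u, v). (l' u, l' v)"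
    "\<lambda>y (u, v). mat_coeff (?\<beta> (from_coeff V y)) u v"
  proof
    fix i :: "(complex^'n) \<times> (complex^'n)" and y z :: "(complex^'m) \<times> (complex^'m) \<Rightarrow> complex"
    have "from_coeff V (\<lambda>j. y j + z j) = from_coeff V y + from_coeff V z"
      by (rule mat_coeff_eqI[OF V]) (simp add: mat_coeff_from_coeff[OF V] mat_coeff_add)
    then show "(case i of (u, v) \<Rightarrow> mat_coeff (?\<beta> (from_coeff V (\<lambda>j. y j + z j))) u v)
      = (case i of (u, v) \<Rightarrow> mat_coeff (?\<beta> (from_coeff V y)) u v)
      + (case i of (u, v) \<Rightarrow> mat_coeff (?\<beta> (from_coeff V z)) u v)"
      by (simp add: hs_adjoint_linear[OF lin] mat_coeff_add split: prod.splits)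
  qed
  have pts_pos: "0 < fst s" "0 < snd s" if "s \<in> pts" for s
    using that pos pos' by (auto simp: pts_def)
  have form: "dominated w \<longleftrightarrow> (\<forall>s\<in>pts. 0 < w s) \<and>
      (\<forall>Y. Re (hs_inner (?\<beta> Y) (multiplier U (\<lambda>u v. w (l u, l v)) (?\<beta> Y)))
         \<le> Re (hs_inner Y (multiplier V (\<lambda>u v. w (l' u, l' v)) Y)))" for w
  proof -
    have 1: "(\<Sum>i\<in>U \<times> U. w (case i of (u, v) \<Rightarrow> (l u, l v)) *
         (cmod (case i of (u, v) \<Rightarrow> mat_coeff (?\<beta> (from_coeff V y)) u v))\<^sup>2)
       = Re (hs_inner (?\<beta> (from_coeff V y)) (multiplier U (\<lambda>u v. w (l u, l v)) (?\<beta> (from_coeff V y))))" for y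
      by (simp add: multiplier_quadratic_form[OF U] sum.cartesian_product case_prod_unfold)
    have 2: "(\<Sum>j\<in>V \<times> V. w (case j of (u, v) \<Rightarrow> (l' u, l' v)) * (cmod (y j))\<^sup>2)
       = Re (hs_inner (from_coeff V y) (multiplier V (\<lambda>u v. w (l' u, l' v)) (from_coeff V y)))" for y
      unfolding multiplier_quadratic_form[OF V] Re_complex_of_real sum.cartesian_product
      by (intro sum.cong refl) (auto simp: mat_coeff_from_coeff[OF V])
    define P where "P Y \<longleftrightarrow> Re (hs_inner (?\<beta> Y) (multiplier U (\<lambda>u v. w (l u, l v)) (?\<beta> Y)))
         \<le> Re (hs_inner Y (multiplier V (\<lambda>u v. w (l' u, l' v)) Y))" for Y
    have "(\<forall>y. P (from_coeff V y)) \<longleftrightarrow> (\<forall>Y. P Y)"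
      using from_coeff_mat_coeff[OF V] by metis
    then show ?thesis unfolding dominated_def 1 2 P_def by (rule arg_cong)
  qed
  have LD: "multiplier U (\<lambda>u v. l u) X = D ** X" for X
    using fun_cong[OF L_op_multiplier[OF _ U], of X] D by (simp add: pos_def_def L_op_def)
  have LD': "multiplier V (\<lambda>u v. l' u) X = \<alpha> D ** X" for X
    using fun_cong[OF L_op_multiplier[OF _ V], of X] D' by (simp add: pos_def_def L_op_def)
  have RD: "multiplier U (\<lambda>u v. l v) X = X ** D" for X
    using fun_cong[OF R_op_multiplier[OF U], of X] by (simp add: R_op_def)
  have RD': "multiplier V (\<lambda>u v. l' v) X = X ** \<alpha> D" for X
    using fun_cong[OF R_op_multiplier[OF V], of X] by (simp add: R_op_def)
  \<comment> \<open>The coordinate functions are the kernels of left and right multiplication.\<close>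
  have "dominated fst" "dominated snd"
    using adjoint_schwarz[OF cp tp D] pts_pos by (simp_all add: form LD LD' RD RD')
  then have m: "dominated m"
    unfolding m_def by (rule dominated_stolarsky_mean[OF _ _ p])
  show ?thesis
    unfolding op_le_def M N
  proof (intro conjI allI)
    show "self_adjoint_op M"
      by (simp add: self_adjoint_op_def M_def multiplier_linear[OF U] multiplier_self_adjoint[OF U])
    have Nlin: "N (X + Y) = N X + N Y" "N (mscale c X) = mscale c (N X)" for X Y c
    proof -
      interpret N: Vector_Spaces.linear mscale mscale N unfolding N_def by (rule multiplier_linear[OF V])
      show "N (X + Y) = N X + N Y" "N (mscale c X) = mscale c (N X)" by (rule N.add N.scale)+
    qed
    have Nadj: "hs_inner (N X) Y = hs_inner X (N Y)" for X Y
      by (simp add: N_def multiplier_self_adjoint[OF V])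
    show "self_adjoint_op (?\<beta> \<circ> N \<circ> \<alpha>)"
      unfolding self_adjoint_op_def
    proof (intro conjI allI)
      show "Vector_Spaces.linear mscale mscale (?\<beta> \<circ> N \<circ> \<alpha>)"
        by (rule mscale_linearI) (simp_all add: \<alpha>.add \<alpha>.scale Nlin hs_adjoint_linear[OF lin])
      fix X Y
      have "hs_inner ((?\<beta> \<circ> N \<circ> \<alpha>) X) Y = cnj (hs_inner Y (?\<beta> (N (\<alpha> X))))"
        by (simp add: cnj_hs_inner)
      also have "\<dots> = hs_inner (N (\<alpha> X)) (\<alpha> Y)"
        by (simp add: cnj_hs_inner flip: hs_adjoint[OF lin])
      also have "\<dots> = hs_inner X ((?\<beta> \<circ> N \<circ> \<alpha>) Y)"
        by (simp add: Nadj hs_adjoint[OF lin])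
      finally show "hs_inner ((?\<beta> \<circ> N \<circ> \<alpha>) X) Y = hs_inner X ((?\<beta> \<circ> N \<circ> \<alpha>) Y)" .
    qed
    fix X
    define Y where "Y = N (\<alpha> X)"
    define q where "q = Re (hs_inner X (?\<beta> Y))"
    have "2 * q = (\<Sum>u\<in>U. \<Sum>v\<in>U. 2 * Re (cnj (mat_coeff X u v) * mat_coeff (?\<beta> Y) u v))"
      by (simp add: q_def hs_inner_mat_coeff[OF U] sum_distrib_left)
    also have "\<dots> \<le> (\<Sum>u\<in>U. \<Sum>v\<in>U. inverse (m (l u, l v)) * (cmod (mat_coeff X u v))\<^sup>2 +
         m (l u, l v) * (cmod (mat_coeff (?\<beta> Y) u v))\<^sup>2)"
      by (intro sum_mono Re_cnj_mult_le_weighted) (simp add: m_def stolarsky_mean_pos pos)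
    also have "\<dots> = Re (hs_inner X (M X)) + Re (hs_inner (?\<beta> Y) (multiplier U (\<lambda>u v. m (l u, l v)) (?\<beta> Y)))"
      by (simp only: M_def multiplier_quadratic_form[OF U] Re_complex_of_real sum.distrib)
    also have "Re (hs_inner (?\<beta> Y) (multiplier U (\<lambda>u v. m (l u, l v)) (?\<beta> Y)))
        \<le> Re (hs_inner Y (multiplier V (\<lambda>u v. m (l' u, l' v)) Y))"
      using m form by blast
    also have "multiplier V (\<lambda>u v. m (l' u, l' v)) Y = \<alpha> X"
    proof (rule mat_coeff_eqI[OF V])
      fix u v assume uv: "u \<in> V" "v \<in> V"
      then have "m (l' u, l' v) \<noteq> 0"
        using stolarsky_mean_pos[of "l' u" "l' v" p] pos' by (simp add: m_def)
      then show "mat_coeff (multiplier V (\<lambda>u v. m (l' u, l' v)) Y) u v = mat_coeff (\<alpha> X) u v"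
        using uv by (simp add: Y_def N_def mat_coeff_multiplier[OF V])
    qed
    also have "Re (hs_inner Y (\<alpha> X)) = q"
      by (subst Re_hs_inner_commute) (simp add: q_def hs_adjoint[OF lin])
    finally have "q \<le> Re (hs_inner X (M X))" by simp
    then show "Re (hs_inner X ((?\<beta> \<circ> N \<circ> \<alpha>) X)) \<le> Re (hs_inner X (M X))"
      by (simp add: q_def Y_def)
  qed
qed

theorem corollary1:
  fixes p :: real
  assumes "p \<in> {-1..2}"
  shows "(\<forall>(D :: complex^'n^'n) (\<alpha> :: complex^'n^'n \<Rightarrow> complex^'m^'m).
            pos_def D \<and> completely_positive \<alpha> \<and> trace_preserving \<alpha> \<and> pos_def (\<alpha> D) \<longrightarrow>
            op_le (hs_adjoint \<alpha> \<circ> inv (J_op (stolarsky p) (\<alpha> D)) \<circ> \<alpha>)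
                  (inv (J_op (stolarsky p) D))) \<and>
         (\<forall>D :: complex^'n^'n. pos_def D \<longrightarrow>
            completely_positive (inv (J_op (stolarsky p) D)))"
  using inv_J_op_stolarsky_monotone inv_J_op_stolarsky_completely_positive assms by blast

end
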